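(* Let $f:\mathbb{R}^n\to\mathbb{R}$ be strongly convex with parameter $\rho>0$ and $L$-smooth with $L>0$, let $g:\mathbb{R}^n\to\mathbb{R}$ be convex, closed and proper (possibly non-smooth), and let $A\in\mathbb{R}^{m\times n}$, $b\in\mathbb{R}^m$. Let $k_{\mathrm p}=k_{\mathrm i}>0$ and consider the dynamics on $\mathbb{R}^{n+m}$ $$\begin{aligned}\dot x&=-x+\mathrm{prox}_{\gamma g}\bigl(x-\gamma(\nabla f(x)+A^{\top}\lambda)\bigr),\\ \dot\lambda&=(k_{\mathrm i}-k_{\mathrm p})Ax+k_{\mathrm p}A\,\mathrm{prox}_{\gamma g}\bigl(x-\gamma(\nabla f(x)+A^{\top}\lambda)\bigr)-k_{\mathrm i}b.\end{aligned}$$ Then for any $\gamma\in\left]0,\frac1L\right]$ and any $$p\in\left[\max\left(\frac{k_{\mathrm p}L}{3},\ \frac{k_{\mathrm p}(1-2\gamma\rho)}{\gamma}\right),\ \frac{k_{\mathrm p}}{\gamma}\right],$$ the dynamics are weakly infinitesimally contracting on $\mathbb{R}^{n+m}$ with respect to the norm $\|\cdot\|_P$, where $$P=\begin{bmatrix}pI_n&0\\0&I_m\end{bmatrix}.$$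
   Context: The feasibility assumption that there exists $\bar x\in\mathbb{R}^n$ with $A\bar x=b$ is in force. The proximal operator of $g$ with parameter $\gamma>0$ is $\mathrm{prox}_{\gamma g}(x)=\arg\min_{z\in\mathbb{R}^n}\, g(z)+\frac{1}{2\gamma}\|x-z\|_2^2$, which is single-valued when $g$ is convex, closed and proper. A function $f$ is strongly convex with parameter $\rho>0$ if $x\mapsto f(x)-\frac{\rho}{2}\|x\|_2^2$ is convex, and $L$-smooth if it is differentiable and $\nabla f$ is Lipschitz with constant $L>0$ (in the Euclidean norm). For a symmetric positive definite matrix $P$, $\|z\|_P=\sqrt{z^\top Pz}$. The logarithmic norm of a square matrix $M$ induced by a norm $\|\cdot\|$ is $\mu(M)=\lim_{h\to0^+}\frac{\|I+hM\|-1}{h}$ (with the induced matrix norm); the one induced by $\|\cdot\|_P$ is $\mu_P(M)=\min\{c\in\mathbb{R}: PM+M^\top P\preceq 2cP\}$. Weak infinitesimal contractivity: for a locally Lipschitz vector field $F:\mathbb{R}^N\to\mathbb{R}^N$, the dynamics $\dot z=F(z)$ are weakly infinitesimally contracting on $\mathbb{R}^N$ with respect to a norm with logarithmic norm $\mu$ if $\mu(DF(z))\le 0$ for almost every $z\in\mathbb{R}^N$ (the Jacobian $DF$ exists almost everywhere by Rademacher's theorem). *)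

theory Defs
  imports "HOL-Analysis.Analysis"
begin

subsection \<open>Convex, closed, proper functions and the proximal operator\<close>

definition ereal_epigraph :: "('a \<Rightarrow> ereal) \<Rightarrow> ('a \<times> real) set" where
  "ereal_epigraph g = {(x, t). g x \<le> ereal t}"

definition ccp :: "('a::euclidean_space \<Rightarrow> ereal) \<Rightarrow> bool" where
  "ccp g \<longleftrightarrow> convex (ereal_epigraph g) \<and> closed (ereal_epigraph g)
     \<and> (\<forall>x. g x \<noteq> -\<infinity>) \<and> (\<exists>x. g x \<noteq> \<infinity>)"

text \<open>The minimiser below exists and is unique when \<open>ccp g\<close> and \<open>\<gamma> > 0\<close>.\<close>

definition prox :: "real \<Rightarrow> ('a::euclidean_space \<Rightarrow> ereal) \<Rightarrow> 'a \<Rightarrow> 'a" where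
  "prox \<gamma> g x = (ARG_MIN (\<lambda>z. g z + ereal (1 / (2 * \<gamma>) * (norm (x - z))\<^sup>2)) z. True)"


subsection \<open>Strong convexity and smoothness\<close>

definition gradient :: "('a::euclidean_space \<Rightarrow> real) \<Rightarrow> 'a \<Rightarrow> 'a" where
  "gradient f x = (THE d. GDERIV f x :> d)"

definition strongly_convex :: "real \<Rightarrow> ('a::euclidean_space \<Rightarrow> real) \<Rightarrow> bool" where
  "strongly_convex \<rho> f \<longleftrightarrow> convex_on UNIV (\<lambda>x. f x - \<rho> / 2 * (norm x)\<^sup>2)"

definition L_smooth :: "real \<Rightarrow> ('a::euclidean_space \<Rightarrow> real) \<Rightarrow> bool" where
  "L_smooth L f \<longleftrightarrow> (\<forall>x. f differentiable (at x)) \<and> L-lipschitz_on UNIV (gradient f)"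


subsection \<open>Logarithmic norms and weak infinitesimal contractivity\<close>

definition is_norm :: "('a::real_vector \<Rightarrow> real) \<Rightarrow> bool" where
  "is_norm N \<longleftrightarrow> (\<forall>x. 0 \<le> N x) \<and> (\<forall>x. N x = 0 \<longleftrightarrow> x = 0)
     \<and> (\<forall>c x. N (c *\<^sub>R x) = \<bar>c\<bar> * N x) \<and> (\<forall>x y. N (x + y) \<le> N x + N y)"

definition induced_norm :: "(real^'k \<Rightarrow> real) \<Rightarrow> real^'k^'k \<Rightarrow> real" where
  "induced_norm N M = (SUP x\<in>{x. N x = 1}. N (M *v x))"

definition log_norm :: "(real^'k \<Rightarrow> real) \<Rightarrow> real^'k^'k \<Rightarrow> real" where
  "log_norm N M = Lim (at_right 0) (\<lambda>h. (induced_norm N (mat 1 + h *\<^sub>R M) - 1) / h)"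

definition weighted_norm :: "real^'k^'k \<Rightarrow> real^'k \<Rightarrow> real" where
  "weighted_norm P z = sqrt (z \<bullet> (P *v z))"

definition locally_lipschitz :: "('a::metric_space \<Rightarrow> 'b::metric_space) \<Rightarrow> bool" where
  "locally_lipschitz F \<longleftrightarrow> (\<forall>z. \<exists>u>0. \<exists>C. C-lipschitz_on (cball z u) F)"

text \<open>
  Existence of the Jacobian almost everywhere is required explicitly,
  since \<open>jacobian F (at z)\<close> is an arbitrary matrix where \<open>F\<close> is not differentiable.
\<close>

definition weakly_inf_contracting :: "(real^'k \<Rightarrow> real) \<Rightarrow> (real^'k \<Rightarrow> real^'k) \<Rightarrow> bool" where
  "weakly_inf_contracting N F \<longleftrightarrow> is_norm N \<and> locally_lipschitz F \<and>
     (AE z in lebesgue. F differentiable (at z) \<and> log_norm N (jacobian F (at z)) \<le> 0)"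


subsection \<open>The proportional-integral proximal dynamics\<close>

text \<open>A point of \<open>real^('n + 'm)\<close> is the stacked vector of its \<open>Inl\<close> and \<open>Inr\<close> components.\<close>

definition upper :: "real^('n::finite + 'm::finite) \<Rightarrow> real^'n" where
  "upper z = (\<chi> i. z $ Inl i)"

definition lower :: "real^('n::finite + 'm::finite) \<Rightarrow> real^'m" where
  "lower z = (\<chi> j. z $ Inr j)"

definition stack :: "real^'n \<Rightarrow> real^'m \<Rightarrow> real^('n::finite + 'm::finite)" where
  "stack x y = (\<chi> k. case k of Inl i \<Rightarrow> x $ i | Inr j \<Rightarrow> y $ j)"

definition block_matrix ::
  "real^'n^'n \<Rightarrow> real^'m^'n \<Rightarrow> real^'n^'m \<Rightarrow> real^'m^'m
     \<Rightarrow> real^('n::finite + 'm::finite)^('n + 'm)" where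
  "block_matrix A B C D = (\<chi> k l. case k of
       Inl i \<Rightarrow> (case l of Inl i' \<Rightarrow> A $ i $ i' | Inr j' \<Rightarrow> B $ i $ j')
     | Inr j \<Rightarrow> (case l of Inl i' \<Rightarrow> C $ j $ i' | Inr j' \<Rightarrow> D $ j $ j'))"

definition prox_PI_field ::
  "real \<Rightarrow> real \<Rightarrow> real \<Rightarrow> (real^'n \<Rightarrow> real) \<Rightarrow> (real^'n \<Rightarrow> ereal)
     \<Rightarrow> real^'n^'m \<Rightarrow> real^'m \<Rightarrow> real^('n::finite + 'm::finite) \<Rightarrow> real^('n + 'm)" where
  "prox_PI_field \<gamma> k\<^sub>p k\<^sub>i f g A b z =
     (let x = upper z; lam = lower z;
          y = prox \<gamma> g (x - \<gamma> *\<^sub>R (gradient f x + transpose A *v lam))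
      in stack (- x + y)
               ((k\<^sub>i - k\<^sub>p) *\<^sub>R (A *v x) + k\<^sub>p *\<^sub>R (A *v y) - k\<^sub>i *\<^sub>R b))"

end

theory Submission
  imports Defs
begin

text \<open>
  Why the theorem holds.  The norm \<open>\<parallel>z\<parallel>\<^sub>P\<close> is the Euclidean norm of \<open>T z\<close> for an injective linear map \<open>T\<close>,
  and for such a norm the logarithmic norm of \<open>M\<close> is at most \<open>0\<close> as soon as
  \<open>T v \<bullet> T (M v) \<le> 0\<close> for all \<open>v\<close> (\<open>log_norm_nonpos\<close>).  If a Lipschitz field satisfies the
  incremental inequality \<open>T (F x - F y) \<bullet> T (x - y) \<le> 0\<close>, then its derivative, wherever it exists,
  inherits the infinitesimal one, and by Rademacher's theorem it exists almost everywhere.  So weak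
  contractivity reduces to the incremental inequality (\<open>weakly_inf_contracting_if_monotone\<close>), and
  no Jacobian of the proximal operator, Hessian of \<open>f\<close> or chain rule ever appears.

  The incremental inequality (\<open>prox_PI_field_monotone\<close>).  Write \<open>x\<close>, \<open>l\<close>, \<open>y\<close>, \<open>w\<close> for the
  differences of primal points, multipliers, proximal points and gradients, and \<open>q = k / \<gamma>\<close>.  For
  equal gains the dual equation contributes \<open>k (l \<bullet> A y)\<close>.  Firm nonexpansiveness of the proximal operator,
  \<open>\<parallel>y\<parallel>\<^sup>2 \<le> y \<bullet> (x - \<gamma> (w + A\<^sup>T l))\<close>, bounds exactly this term and thereby removes \<open>l\<close>; what is left
  to prove is \<open>((p + q) x - k w) \<bullet> y \<le> p \<parallel>x\<parallel>\<^sup>2 + q \<parallel>y\<parallel>\<^sup>2\<close>, for which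
  \<open>\<parallel>(p + q) x - k w\<parallel>\<^sup>2 \<le> 4 p q \<parallel>x\<parallel>\<^sup>2\<close> is enough.  Cocoercivity confines \<open>w\<close> to the ball
  with diameter from \<open>\<rho> x\<close> to \<open>L x\<close>, on which the left side is largest at \<open>w = \<rho> x\<close>, and
  \<open>(p + q - k \<rho>)\<^sup>2 \<le> 4 p q\<close> is what the admissible interval for \<open>p\<close> guarantees
  (\<open>cross_term_bound\<close>).

  Rademacher's theorem.  On the real line, the Vitali covering theorem shows that the difference
  quotients of a Lipschitz function oscillate only on a null set; Tonelli's theorem carries this to
  every direction in Euclidean space, so the partial derivatives exist almost everywhere.  To
  combine them into a total derivative, consider a closed set \<open>A\<close> on which one partial derivative
  is controlled uniformly.  Almost every point of \<open>A\<close> is not porous: the distance from \<open>x + w\<close> to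
  \<open>A\<close> is \<open>o(\<parallel>w\<parallel>)\<close>.  A Lipschitz function therefore has at \<open>x + w\<close> the increments that it has at a
  nearby point of \<open>A\<close>, up to \<open>o(\<parallel>w\<parallel>)\<close>, and the increments along the coordinate axes add up.
\<close>

section \<open>Comparison of measures by Vitali coverings\<close>

text \<open>
  A measure that is small on arbitrarily small balls about every point of \<open>S\<close> is small on \<open>S\<close>: the
  Vitali covering theorem fills almost all of \<open>S\<close> with disjoint such balls inside an open set that is
  hardly larger than \<open>S\<close>.  The balls only have to contain the point, they need not be centred at
  it; this freedom is used below for one-sided intervals and for balls next to a porous point.
\<close>

lemma Vitali_comparison:
  fixes \<nu> :: "'a::euclidean_space measure" and c :: real
  assumes \<nu>: "sets \<nu> = sets borel"
    and null: "\<And>N. N \<in> null_sets lborel \<Longrightarrow> emeasure \<nu> N = 0"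
    and S: "S \<in> sets borel" and "0 \<le> c"
    and small: "\<And>x d. x \<in> S \<Longrightarrow> 0 < d \<Longrightarrow>
      \<exists>a r. 0 < r \<and> r < d \<and> x \<in> cball a r \<and>
        emeasure \<nu> (S \<inter> cball a r) \<le> ennreal c * emeasure lborel (cball a r)"
  shows "emeasure \<nu> S \<le> ennreal c * emeasure lborel S"
proof (rule ennreal_le_epsilon)
  fix \<epsilon> :: real
  assume "0 < \<epsilon>"
  \<comment> \<open>The error \<open>c * \<delta>\<close> must stay below \<open>\<epsilon>\<close>; the summand \<open>1\<close> covers \<open>c = 0\<close>.\<close>
  define \<delta> where "\<delta> = \<epsilon> / (c + 1)"
  have "0 < \<delta>" using \<open>0 < \<epsilon>\<close> \<open>0 \<le> c\<close> by (simp add: \<delta>_def)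
  obtain U where U: "open U" "S \<subseteq> U" "emeasure lborel (U - S) < \<delta>"
    using outer_regular_lborel[OF S \<open>0 < \<delta>\<close>] by blast
  define K where "K = {(a, r). 0 < r \<and> cball a r \<subseteq> U \<and>
      emeasure \<nu> (S \<inter> cball a r) \<le> ennreal c * emeasure lborel (cball a r)}"
  have fine: "\<exists>i. i \<in> K \<and> x \<in> cball (fst i) (snd i) \<and> snd i < d" if x: "x \<in> S" and d: "0 < d" for x d
  proof -
    obtain e where e: "0 < e" "cball x e \<subseteq> U"
      using U x by (meson open_contains_cball subsetD)
    obtain a r where ar: "0 < r" "r < min d (e / 2)" "x \<in> cball a r"
        "emeasure \<nu> (S \<inter> cball a r) \<le> ennreal c * emeasure lborel (cball a r)"
      using small[OF x, of "min d (e / 2)"] d e by auto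
    have "cball a r \<subseteq> cball x e"
    proof
      fix y assume "y \<in> cball a r"
      with ar dist_triangle[of x y a] show "y \<in> cball x e" by (simp add: dist_commute)
    qed
    with ar e have "(a, r) \<in> K" by (auto simp: K_def)
    with ar show ?thesis by (intro exI[of _ "(a, r)"]) auto
  qed
  obtain C where C: "countable C" "C \<subseteq> K"
      "pairwise (\<lambda>i j. disjnt (cball (fst i) (snd i)) (cball (fst j) (snd j))) C"
      "negligible (S - (\<Union>i\<in>C. cball (fst i) (snd i)))"
  proof (rule Vitali_covering_theorem_cballs[of K snd S fst])
    show "\<exists>i. i \<in> K \<and> x \<in> cball (fst i) (snd i) \<and> snd i < d" if "x \<in> S" "0 < d" for x d
      using that by (rule fine)
    show "0 < snd i" if "i \<in> K" for i
      using that by (simp add: K_def case_prod_beta)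
  qed (rule that)
  let ?B = "\<lambda>i. cball (fst i) (snd i) :: 'a set"
  have disj: "disjoint_family_on ?B C"
    using C(3) by (auto simp: disjoint_family_on_def pairwise_def disjnt_def)
  have disjS: "disjoint_family_on (\<lambda>i. S \<inter> ?B i) C"
    using disj by (rule disjoint_family_on_bisimulation) auto
  have BU: "(\<Union>i\<in>C. ?B i) \<in> sets borel"
    using C(1) by (intro sets.countable_UN') auto
  have "emeasure lborel (S - (\<Union>i\<in>C. ?B i)) = 0"
    using C(4) S BU by (simp add: negligible_iff_emeasure0)
  then have 0: "emeasure \<nu> (S - (\<Union>i\<in>C. ?B i)) = 0"
    using S BU by (intro null) (auto simp: null_sets_def)
  have "emeasure \<nu> S \<le> emeasure \<nu> ((S - (\<Union>i\<in>C. ?B i)) \<union> (\<Union>i\<in>C. S \<inter> ?B i))"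
    using S BU C(1) by (intro emeasure_mono) (auto simp: \<nu> intro!: sets.countable_UN')
  also have "\<dots> \<le> emeasure \<nu> (S - (\<Union>i\<in>C. ?B i)) + emeasure \<nu> (\<Union>i\<in>C. S \<inter> ?B i)"
    using S BU C(1) by (intro emeasure_subadditive) (auto simp: \<nu> intro!: sets.countable_UN')
  also have "\<dots> = (\<integral>\<^sup>+i. emeasure \<nu> (S \<inter> ?B i) \<partial>count_space C)"
    using S C(1) disjS unfolding 0
    by (subst emeasure_UN_countable) (auto simp: \<nu>)
  also have "\<dots> \<le> (\<integral>\<^sup>+i. ennreal c * emeasure lborel (?B i) \<partial>count_space C)"
    using C(2) by (intro nn_integral_mono) (auto simp: K_def)
  also have "\<dots> = ennreal c * emeasure lborel (\<Union>i\<in>C. ?B i)"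
    using C(1) disj
    by (subst emeasure_UN_countable) (auto simp: nn_integral_cmult)
  also have "\<dots> \<le> ennreal c * emeasure lborel U"
  proof -
    have "(\<Union>i\<in>C. ?B i) \<subseteq> U" using C(2) unfolding K_def by fastforce
    with \<open>open U\<close> show ?thesis by (intro mult_left_mono emeasure_mono) auto
  qed
  also have "emeasure lborel U \<le> emeasure lborel S + emeasure lborel (U - S)"
    using U S emeasure_subadditive[of S lborel "U - S"] by (simp add: Un_absorb1)
  also have "\<dots> \<le> emeasure lborel S + ennreal \<delta>"
    using U(3) by (intro add_left_mono) simp
  also have "ennreal c * (emeasure lborel S + ennreal \<delta>) =
      ennreal c * emeasure lborel S + ennreal (c * \<delta>)"
    using \<open>0 \<le> c\<close> \<open>0 < \<delta>\<close> by (simp add: distrib_left ennreal_mult')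
  also have "c * \<delta> \<le> \<epsilon>"
    using \<open>0 < \<epsilon>\<close> \<open>0 \<le> c\<close> by (simp add: \<delta>_def field_simps)
  finally show "emeasure \<nu> S \<le> ennreal c * emeasure lborel S + ennreal \<epsilon>"
    by (simp add: mult_left_mono add_left_mono ennreal_leI)
qed

lemma emeasure_eq_0_if_le_fraction:
  fixes S :: "'a::euclidean_space set" and c :: real
  assumes "S \<in> sets borel" "emeasure lborel S \<noteq> \<infinity>" "0 \<le> c" "c < 1"
    and "emeasure lborel S \<le> ennreal c * emeasure lborel S"
  shows "emeasure lborel S = 0"
proof -
  have "emeasure lborel S = ennreal (measure lborel S)"
    using assms(2) by (simp add: emeasure_eq_ennreal_measure)
  with assms have "measure lborel S \<le> c * measure lborel S"
    by (metis ennreal_le_iff ennreal_mult'' measure_nonneg mult_nonneg_nonneg)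
  then have "(1 - c) * measure lborel S \<le> 0" by (simp add: algebra_simps)
  then have "measure lborel S = 0"
    using assms(4) by (smt (verit) measure_nonneg mult_pos_pos)
  then show ?thesis using \<open>emeasure lborel S = _\<close> by simp
qed

lemma frequently_at_0_iff:
  "(\<exists>\<^sub>F t in at (0::'b::real_normed_vector). P t) \<longleftrightarrow> (\<forall>d>0. \<exists>t. t \<noteq> 0 \<and> norm t < d \<and> P t)"
  by (auto simp: frequently_def eventually_at)

text \<open>
  Exceptional sets of the form ``for arbitrarily small \<open>t\<close>'' are \<open>G\<^sub>\<delta>\<close> sets when each
  condition is open, which settles measurability of all the exceptional sets that occur below.
\<close>

lemma borel_frequently_at_0:
  fixes P :: "'a::topological_space \<Rightarrow> 'b::real_normed_vector \<Rightarrow> bool"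
  assumes "\<And>t. t \<noteq> 0 \<Longrightarrow> open {x. P x t}"
  shows "{x. \<exists>\<^sub>F t in at 0. P x t} \<in> sets borel"
proof -
  have "{x. \<exists>\<^sub>F t in at 0. P x t} =
      (\<Inter>n. \<Union>t\<in>{t. t \<noteq> 0 \<and> norm t < inverse (real (Suc n))}. {x. P x t})"
  proof (intro equalityI subsetI)
    fix x assume "x \<in> (\<Inter>n. \<Union>t\<in>{t. t \<noteq> 0 \<and> norm t < inverse (real (Suc n))}. {x. P x t})"
    then have *: "\<exists>t. t \<noteq> 0 \<and> norm t < inverse (real (Suc n)) \<and> P x t" for n
      by auto
    have "\<exists>t. t \<noteq> 0 \<and> norm t < d \<and> P x t" if "0 < d" for d
      using *  reals_Archimedean[OF that] by (meson less_trans)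
    then show "x \<in> {x. \<exists>\<^sub>F t in at 0. P x t}" by (simp add: frequently_at_0_iff)
  next
    fix x assume "x \<in> {x. \<exists>\<^sub>F t in at 0. P x t}"
    then have "\<exists>t. t \<noteq> 0 \<and> norm t < inverse (real (Suc n)) \<and> P x t" for n
      by (simp add: frequently_at_0_iff)
    then show "x \<in> (\<Inter>n. \<Union>t\<in>{t. t \<noteq> 0 \<and> norm t < inverse (real (Suc n))}. {x. P x t})"
      by auto
  qed
  moreover have "(\<Union>t\<in>{t. t \<noteq> 0 \<and> norm t < inverse (real (Suc n))}. {x. P x t}) \<in> sets borel" for n
    using assms by (intro borel_open open_UN) auto
  ultimately show ?thesis by auto
qed

section \<open>Rademacher's theorem\<close>

text \<open>
  The rational levels \<open>p < q\<close> between the lower and the upper derivative turn failure of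
  differentiability into a countable union of sets; oscillation between fixed levels can be
  measured on both sides against Lebesgue measure.
\<close>

definition oscillates :: "('a::real_normed_vector \<Rightarrow> real) \<Rightarrow> 'a \<Rightarrow> real \<Rightarrow> real \<Rightarrow> 'a \<Rightarrow> bool" where
  "oscillates F e p q x \<longleftrightarrow>
     (\<exists>\<^sub>F t in at 0. (F (x + t *\<^sub>R e) - F x) / t < p) \<and>
     (\<exists>\<^sub>F t in at 0. q < (F (x + t *\<^sub>R e) - F x) / t)"

lemma borel_oscillates:
  fixes F :: "'a::real_normed_vector \<Rightarrow> real"
  assumes "continuous_on UNIV F"
  shows "{x. oscillates F e p q x} \<in> sets borel"
proof -
  have cont: "continuous_on UNIV (\<lambda>x. (F (x + t *\<^sub>R e) - F x) / t)" if "t \<noteq> 0" for t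
    using that by (intro continuous_intros continuous_on_compose2[OF assms]) auto
  have "{x. \<exists>\<^sub>F t in at 0. (F (x + t *\<^sub>R e) - F x) / t < p} \<in> sets borel"
    by (intro borel_frequently_at_0 open_Collect_less continuous_on_const cont)
  moreover have "{x. \<exists>\<^sub>F t in at 0. q < (F (x + t *\<^sub>R e) - F x) / t} \<in> sets borel"
    by (intro borel_frequently_at_0 open_Collect_less continuous_on_const cont)
  ultimately have "{x. \<exists>\<^sub>F t in at 0. (F (x + t *\<^sub>R e) - F x) / t < p} \<inter>
      {x. \<exists>\<^sub>F t in at 0. q < (F (x + t *\<^sub>R e) - F x) / t} \<in> sets borel"
    by (rule sets.Int)
  then show ?thesis by (simp add: oscillates_def Collect_conj_eq)
qed

lemma null_sets_inverse_vimage: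
  fixes h k :: "real \<Rightarrow> real"
  assumes "M-lipschitz_on UNIV h" "continuous_on UNIV k"
    and inv: "\<And>x. k (h x) = x" "\<And>y. h (k y) = y"
    and N: "N \<in> null_sets lborel"
  shows "emeasure lborel (k -` N) = 0"
proof -
  have "N \<in> sets borel" using N by auto
  then have borel: "k -` N \<in> sets borel"
    using borel_measurable_continuous_onI[OF assms(2)] by (metis measurable_sets_borel)
  have "negligible N" using N by (metis negligible_iff_null_sets null_sets_completionI)
  moreover have "norm (h y - h x) \<le> M * norm (y - x)" for x y
    using assms(1) by (metis UNIV_I lipschitz_on_normD)
  ultimately have "negligible (h ` N)"
    by (intro negligible_locally_Lipschitz_image) (auto intro!: exI[of _ UNIV] exI[of _ M])
  moreover have "h ` N = k -` N"
    using inv by (metis (mono_tags, lifting) bij_def bij_vimage_eq_inv_image inv_equality injI surjI)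
  ultimately show ?thesis
    using borel by (simp add: negligible_iff_emeasure0)
qed

text \<open>
  Here \<open>k -` S\<close> is the image \<open>h ` S\<close>, written through the inverse \<open>k\<close> so that it is the
  push-forward of Lebesgue measure under \<open>k\<close>.  An interval on which \<open>h\<close> has slope below \<open>c\<close> is mapped to an
  interval at most \<open>c\<close> times as long, and such intervals form a Vitali cover of \<open>S\<close>.
\<close>

lemma emeasure_preimage_le_slope:
  fixes h k :: "real \<Rightarrow> real" and c :: real
  assumes h: "M-lipschitz_on UNIV h" "strict_mono h" and k: "continuous_on UNIV k"
    and inv: "\<And>x. k (h x) = x" "\<And>y. h (k y) = y"
    and S: "S \<in> sets borel" and "0 \<le> c"
    and slope: "\<And>x. x \<in> S \<Longrightarrow> \<exists>\<^sub>F t in at 0. (h (x + t) - h x) / t < c"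
  shows "emeasure lborel (k -` S) \<le> ennreal c * emeasure lborel S"
proof -
  define \<nu> where "\<nu> = distr lborel borel k"
  have k_borel: "k \<in> borel_measurable lborel"
    using borel_measurable_continuous_onI[OF k] by simp
  have \<nu>: "emeasure \<nu> B = emeasure lborel (k -` B)" if "B \<in> sets borel" for B
    using that k_borel by (simp add: \<nu>_def emeasure_distr)
  have "emeasure \<nu> S \<le> ennreal c * emeasure lborel S"
  proof (rule Vitali_comparison)
    show "emeasure \<nu> N = 0" if "N \<in> null_sets lborel" for N
      using null_sets_inverse_vimage[OF h(1) k inv that] that by (subst \<nu>) auto
    fix x d :: real
    assume "x \<in> S" "0 < d"
    then obtain t where t: "t \<noteq> 0" "\<bar>t\<bar> < d" "(h (x + t) - h x) / t < c"
      using slope[OF \<open>x \<in> S\<close>] by (auto simp: frequently_at_0_iff)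
    define u v where "u = min x (x + t)" and "v = max x (x + t)"
    have uv: "u < v" "v - u = \<bar>t\<bar>" "cball (x + t / 2) (\<bar>t\<bar> / 2) = {u..v}"
      using t(1) by (auto simp: u_def v_def cball_eq_atLeastAtMost min_def max_def)
    have "(h v - h u) / (v - u) < c"
      using t by (auto simp: u_def v_def min_def max_def divide_simps split: if_splits)
    then have le: "h v - h u \<le> c * (v - u)"
      using uv(1) by (simp add: field_simps)
    have "k -` {u..v} = {h u..h v}"
      using inv h(2) by (auto simp: vimage_def) (metis strict_mono_less_eq)+
    then have "emeasure \<nu> {u..v} = ennreal (h v - h u)"
      using h(2) uv(1) by (simp add: \<nu> strict_mono_less_eq)
    also have "\<dots> \<le> ennreal (c * (v - u))"
      using le by (rule ennreal_leI)
    also have "\<dots> = ennreal c * emeasure lborel {u..v}"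
      using uv(1) \<open>0 \<le> c\<close> by (simp add: ennreal_mult)
    finally have "emeasure \<nu> {u..v} \<le> ennreal c * emeasure lborel {u..v}" .
    moreover have "emeasure \<nu> (S \<inter> {u..v}) \<le> emeasure \<nu> {u..v}"
      by (rule emeasure_mono) (auto simp: \<nu>_def)
    ultimately have "emeasure \<nu> (S \<inter> {u..v}) \<le> ennreal c * emeasure lborel {u..v}"
      by (rule order_trans[rotated])
    then show "\<exists>a r. 0 < r \<and> r < d \<and> x \<in> cball a r \<and>
        emeasure \<nu> (S \<inter> cball a r) \<le> ennreal c * emeasure lborel (cball a r)"
      using t uv by (intro exI[of _ "x + t / 2"] exI[of _ "\<bar>t\<bar> / 2"]) (auto simp: u_def v_def)
  qed (use S \<open>0 \<le> c\<close> in \<open>auto simp: \<nu>_def\<close>)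
  then show ?thesis using S by (simp add: \<nu>)
qed

text \<open>
  Adding a linear function makes \<open>F\<close> an increasing bi-Lipschitz homeomorphism \<open>h\<close> and only shifts
  the levels.  On the oscillation set \<open>S\<close> small slopes give \<open>\<bar>h S\<bar> \<le> p' \<bar>S\<bar>\<close>; large slopes are small
  slopes of the inverse and give \<open>\<bar>S\<bar> \<le> \<bar>h S\<bar> / q'\<close>.  Since \<open>p' < q'\<close>, bounded parts of \<open>S\<close> are null.
\<close>

lemma null_sets_oscillates_real:
  fixes F :: "real \<Rightarrow> real"
  assumes F: "L-lipschitz_on UNIV F" and "p < q"
  shows "{x. oscillates F 1 p q x} \<in> null_sets lborel"
proof -
  define h where "h x = F x + (L + 1) * x" for x
  define p' q' where "p' = p + (L + 1)" and "q' = q + (L + 1)"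
  have "0 \<le> L" using F by (rule lipschitz_on_nonneg)
  have Fle: "\<bar>F y - F x\<bar> \<le> L * \<bar>y - x\<bar>" for x y
    using lipschitz_on_normD[OF F, of y x] by simp
  have h_ge: "y - x \<le> h y - h x" if "x \<le> y" for x y
    using Fle[of y x] that by (simp add: h_def algebra_simps)
  have h_mono: "strict_mono h"
    unfolding strict_mono_def using h_ge by (smt (verit))
  have h_lip: "(L + (L + 1))-lipschitz_on UNIV h"
    unfolding h_def
    using lipschitz_on_add[OF F lipschitz_on_cmult_real_nonneg[OF lipschitz_on_id, of "L + 1"]] \<open>0 \<le> L\<close>
    by simp
  have h_cont: "continuous_on UNIV h"
    using h_lip by (rule lipschitz_on_continuous_on)
  have "\<exists>x. h x = y" for y
  proof -
    define r where "r = \<bar>y - h 0\<bar>"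
    have "h (- r) \<le> y" "y \<le> h r" "- r \<le> r"
      using h_ge[of 0 r] h_ge[of "- r" 0] by (auto simp: r_def)
    then show ?thesis
      using IVT'[of h "- r" y r] h_cont continuous_on_subset by blast
  qed
  then obtain k where hk: "\<And>y. h (k y) = y" by metis
  then have kh: "k (h x) = x" for x
    using h_mono by (metis strict_mono_eq)
  have k_lip: "1-lipschitz_on UNIV k"
  proof (rule lipschitz_onI)
    show "dist (k x) (k y) \<le> 1 * dist x y" for x y
      using h_ge[of "k x" "k y"] h_ge[of "k y" "k x"] unfolding hk dist_real_def
      by (cases "k x \<le> k y") auto
  qed simp
  have k_cont: "continuous_on UNIV k"
    using k_lip by (rule lipschitz_on_continuous_on)
  have k_mono: "strict_mono k"
    unfolding strict_mono_def using h_mono hk by (metis strict_mono_less)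
  have quotient: "(h (x + t) - h x) / t = (F (x + t) - F x) / t + (L + 1)" if "t \<noteq> 0" for x t
    using that by (simp add: h_def field_simps)
  have quotient_ge: "1 \<le> (h (x + t) - h x) / t" if "t \<noteq> 0" for x t
    using h_ge[of x "x + t"] h_ge[of "x + t" x] that by (cases "0 < t") (auto simp: field_simps)
  have iff: "(h (x + t) - h x) / t < p' \<longleftrightarrow> (F (x + t) - F x) / t < p"
      "q' < (h (x + t) - h x) / t \<longleftrightarrow> q < (F (x + t) - F x) / t" if "t \<noteq> 0" for x t
    using that by (simp_all add: quotient p'_def q'_def)
  have low: "\<exists>\<^sub>F t in at 0. (h (x + t) - h x) / t < p'" if "oscillates F 1 p q x" for x
    using that by (simp add: oscillates_def frequently_at_0_iff iff cong: conj_cong)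
  have high: "\<exists>\<^sub>F t in at 0. q' < (h (x + t) - h x) / t" if "oscillates F 1 p q x" for x
    using that by (simp add: oscillates_def frequently_at_0_iff iff cong: conj_cong)
  have osc_borel: "{x. oscillates F 1 p q x} \<in> sets borel"
    by (intro borel_oscillates lipschitz_on_continuous_on[OF F])
  show ?thesis
  proof (cases "0 < p'")
    \<comment> \<open>Slopes of \<open>h\<close> are at least \<open>1\<close>, so none lies below a level \<open>p' \<le> 0\<close>.\<close>
    case False
    have "\<not> oscillates F 1 p q x" for x
    proof
      assume "oscillates F 1 p q x"
      from low[OF this] obtain t where "t \<noteq> 0" "(h (x + t) - h x) / t < p'"
        by (auto simp: frequently_at_0_iff dest: spec[of _ 1])
      with quotient_ge[of t x] False show False by linarith
    qed
    then show ?thesis by simp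
  next
    case True
    then have "0 < q'" "p' < q'" using \<open>p < q\<close> by (simp_all add: p'_def q'_def)
    have "emeasure lborel ({x. oscillates F 1 p q x} \<inter> cball 0 (real n)) = 0" for n
    proof -
      define S where "S = {x. oscillates F 1 p q x} \<inter> cball 0 (real n)"
      have S: "S \<in> sets borel" using osc_borel by (simp add: S_def)
      have kS: "k -` S \<in> sets borel"
        using S borel_measurable_continuous_onI[OF k_cont] by (metis measurable_sets_borel)
      have "emeasure lborel (k -` S) \<le> ennreal p' * emeasure lborel S"
        using True low
        by (intro emeasure_preimage_le_slope[OF h_lip h_mono k_cont kh hk S]) (auto simp: S_def)
      moreover have "emeasure lborel (h -` (k -` S)) \<le> ennreal (1 / q') * emeasure lborel (k -` S)"
      proof (rule emeasure_preimage_le_slope[OF k_lip k_mono h_cont hk kh kS])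
        fix y assume "y \<in> k -` S"
        define x where "x = k y"
        have "oscillates F 1 p q x" using \<open>y \<in> k -` S\<close> by (simp add: x_def S_def)
        have y: "y = h x" by (simp add: x_def hk)
        show "\<exists>\<^sub>F s in at 0. (k (y + s) - k y) / s < 1 / q'"
          unfolding frequently_at_0_iff
        proof (intro allI impI)
          fix d :: real assume "0 < d"
          define M where "M = L + (L + 1)"
          have "0 < M" using \<open>0 \<le> L\<close> by (simp add: M_def)
          then obtain t where t: "t \<noteq> 0" "\<bar>t\<bar> < d / M" "q' < (h (x + t) - h x) / t"
            using high[OF \<open>oscillates F 1 p q x\<close>] \<open>0 < d\<close>
            unfolding frequently_at_0_iff by (metis divide_pos_pos real_norm_def)
          define s where "s = h (x + t) - h x"
          have "\<bar>s\<bar> \<le> M * \<bar>t\<bar>"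
            using lipschitz_on_normD[OF h_lip, of "x + t" x] by (simp add: s_def M_def)
          also have "\<dots> < d" using t(2) \<open>0 < M\<close> by (simp add: field_simps)
          finally have "\<bar>s\<bar> < d" .
          moreover have "s \<noteq> 0" using t(3) \<open>0 < q'\<close> by (auto simp: s_def)
          moreover have "k (y + s) - k y = t" by (simp add: y s_def kh)
          moreover have "t / s < 1 / q'"
          proof -
            have "q' < s / t" using t(3) by (simp add: s_def)
            then have "1 / (s / t) < 1 / q'"
              using \<open>0 < q'\<close> by (metis inverse_eq_divide less_imp_inverse_less)
            then show ?thesis by simp
          qed
          ultimately show "\<exists>s. s \<noteq> 0 \<and> norm s < d \<and> (k (y + s) - k y) / s < 1 / q'"
            by (intro exI[of _ s]) simp
        qed
      qed (use \<open>0 < q'\<close> in simp)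
      moreover have "h -` (k -` S) = S" by (auto simp: kh)
      ultimately have "emeasure lborel S \<le> ennreal (1 / q') * (ennreal p' * emeasure lborel S)"
        by (metis mult_left_mono order_trans zero_le)
      also have "\<dots> = ennreal (p' / q') * emeasure lborel S"
        using True \<open>0 < q'\<close> by (simp add: ennreal_mult'[symmetric] mult.assoc[symmetric])
      finally have "emeasure lborel S \<le> ennreal (p' / q') * emeasure lborel S" .
      moreover have "emeasure lborel S \<noteq> \<infinity>"
        using emeasure_bounded_finite[of S] by (simp add: S_def bounded_Int less_top)
      ultimately show ?thesis
        using S True \<open>p' < q'\<close> unfolding S_def[symmetric]
        by (intro emeasure_eq_0_if_le_fraction[of S "p' / q'"]) auto
    qed
    then have "{x. oscillates F 1 p q x} \<inter> cball 0 (real n) \<in> null_sets lborel" for n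
      using osc_borel by (auto simp: null_sets_def)
    then have "(\<Union>n. {x. oscillates F 1 p q x} \<inter> cball 0 (real n)) \<in> null_sets lborel"
      by (rule null_sets_UN)
    moreover have "(\<Union>n. {x. oscillates F 1 p q x} \<inter> cball 0 (real n)) = {x. oscillates F 1 p q x}"
      by (auto simp: real_arch_simple)
    ultimately show ?thesis by simp
  qed
qed

text \<open>
  Integrate the indicator of \<open>N\<close> at \<open>x + t e\<close> over all \<open>x\<close> and \<open>t\<close>.  Integrating over \<open>t\<close> first gives
  \<open>0\<close>; integrating over \<open>x\<close> first gives, by translation invariance, the integral of the constant
  \<open>\<bar>N\<bar>\<close> over the whole line, which is infinite unless \<open>N\<close> is null.
\<close>

lemma null_sets_if_null_on_lines:
  fixes N :: "'a::euclidean_space set"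
  assumes N: "N \<in> sets borel"
    and lines: "\<And>x. {t::real. x + t *\<^sub>R e \<in> N} \<in> null_sets lborel"
  shows "N \<in> null_sets lborel"
proof -
  let ?f = "\<lambda>(x, t). indicator N (x + t *\<^sub>R e) :: ennreal"
  have meas: "(\<lambda>z. fst z + snd z *\<^sub>R e) \<in> borel_measurable (borel \<Otimes>\<^sub>M borel :: ('a \<times> real) measure)"
    by measurable
  then have f: "?f \<in> borel_measurable (lborel \<Otimes>\<^sub>M lborel)"
    using N measurable_compose[OF meas borel_measurable_indicator[OF N]]
    by (simp add: case_prod_beta cong: measurable_cong_sets)
  have inner: "(\<integral>\<^sup>+t. ?f (x, t) \<partial>lborel) = 0" for x
  proof -
    have "(\<integral>\<^sup>+t. ?f (x, t) \<partial>lborel) = (\<integral>\<^sup>+t. indicator {t. x + t *\<^sub>R e \<in> N} t \<partial>lborel)"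
      by (intro nn_integral_cong) (auto simp: indicator_def)
    also have "\<dots> = emeasure lborel {t. x + t *\<^sub>R e \<in> N}"
      using lines[of x] by (intro nn_integral_indicator) auto
    finally show ?thesis using lines[of x] by auto
  qed
  have outer: "(\<integral>\<^sup>+x. ?f (x, t) \<partial>lborel) = emeasure lborel N" for t
  proof -
    have "(\<integral>\<^sup>+x. ?f (x, t) \<partial>lborel) = (\<integral>\<^sup>+x. indicator N (t *\<^sub>R e + x) \<partial>lborel)"
      by (simp add: add.commute)
    also have "\<dots> = (\<integral>\<^sup>+x. indicator N x \<partial>distr lborel borel ((+) (t *\<^sub>R e)))"
      using N by (subst nn_integral_distr) auto
    also have "\<dots> = emeasure lborel N"
      using N by (simp add: lborel_distr_plus)
    finally show ?thesis .
  qed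
  have "(\<integral>\<^sup>+t. emeasure lborel N \<partial>(lborel :: real measure)) =
      (\<integral>\<^sup>+t. (\<integral>\<^sup>+x. ?f (x, t) \<partial>lborel) \<partial>lborel)"
    by (simp only: outer)
  also have "\<dots> = (\<integral>\<^sup>+x. (\<integral>\<^sup>+t. ?f (x, t) \<partial>lborel) \<partial>lborel)"
    using f by (rule lborel_pair.Fubini)
  also have "\<dots> = 0" by (simp only: inner) simp
  finally have "emeasure lborel N * \<infinity> = 0" by simp
  then have "emeasure lborel N = 0" by (simp add: ennreal_mult_eq_top_iff split: if_splits)
  then show ?thesis using N by (auto simp: null_sets_def)
qed

lemma null_sets_oscillates:
  fixes F :: "'a::euclidean_space \<Rightarrow> real"
  assumes F: "L-lipschitz_on UNIV F" and "p < q"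
  shows "{x. oscillates F e p q x} \<in> null_sets lborel"
proof (rule null_sets_if_null_on_lines)
  show "{x. oscillates F e p q x} \<in> sets borel"
    by (intro borel_oscillates lipschitz_on_continuous_on[OF F])
next
  fix x
  define G where "G t = F (x + t *\<^sub>R e)" for t
  have "(L * norm e)-lipschitz_on UNIV G"
  proof (rule lipschitz_onI)
    fix s t :: real
    have "dist (G s) (G t) \<le> L * norm ((x + s *\<^sub>R e) - (x + t *\<^sub>R e))"
      using lipschitz_onD[OF F, of "x + s *\<^sub>R e" "x + t *\<^sub>R e"] by (simp add: G_def dist_norm)
    also have "\<dots> = L * norm e * dist s t"
      by (simp add: dist_norm flip: scaleR_diff_left)
    finally show "dist (G s) (G t) \<le> L * norm e * dist s t" .
  qed (simp add: lipschitz_on_nonneg[OF F])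
  then have "{t. oscillates G 1 p q t} \<in> null_sets lborel"
    using \<open>p < q\<close> by (rule null_sets_oscillates_real)
  also have "{t. oscillates G 1 p q t} = {t. x + t *\<^sub>R e \<in> {x. oscillates F e p q x}}"
    by (simp add: oscillates_def G_def algebra_simps)
  finally show "{t. x + t *\<^sub>R e \<in> {x. oscillates F e p q x}} \<in> null_sets lborel" .
qed

lemma convergent_if_no_oscillation:
  fixes F :: "'a::real_normed_vector \<Rightarrow> real"
  assumes F: "L-lipschitz_on UNIV F"
    and no_osc: "\<And>p q. p \<in> \<rat> \<Longrightarrow> q \<in> \<rat> \<Longrightarrow> p < q \<Longrightarrow> \<not> oscillates F e p q x"
  shows "\<exists>D. ((\<lambda>t. (F (x + t *\<^sub>R e) - F x) / t) \<longlongrightarrow> D) (at 0)"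
proof -
  define Q where "Q t = (F (x + t *\<^sub>R e) - F x) / t" for t
  let ?Q = "\<lambda>t. ereal (Q t)"
  define M where "M = L * norm e"
  have bound: "\<bar>Q t\<bar> \<le> M" if "t \<noteq> 0" for t
    using lipschitz_on_normD[OF F, of "x + t *\<^sub>R e" x] that
    by (simp add: Q_def M_def divide_simps mult_ac)
  have ev: "\<forall>\<^sub>F t in at 0. ereal (- M) \<le> ?Q t" "\<forall>\<^sub>F t in at 0. ?Q t \<le> ereal M"
    using bound by (auto simp: eventually_at_filter abs_le_iff intro!: always_eventually) (metis minus_le_iff)
  have "Liminf (at 0) ?Q = Limsup (at 0) ?Q"
  proof (rule ccontr)
    assume "Liminf (at 0) ?Q \<noteq> Limsup (at 0) ?Q"
    then have "Liminf (at 0) ?Q < Limsup (at 0) ?Q"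
      using Liminf_le_Limsup[of "at (0::real)" ?Q] by simp
    then obtain p q :: rat where pq: "Liminf (at 0) ?Q < ereal (real_of_rat p)"
        "real_of_rat p < real_of_rat q" "ereal (real_of_rat q) < Limsup (at 0) ?Q"
      by (metis ereal_dense3 ereal_less(2) less_ereal.simps(1))
    have "\<exists>\<^sub>F t in at 0. Q t < real_of_rat p"
    proof (rule ccontr)
      assume "\<not> ?thesis"
      then have "\<forall>\<^sub>F t in at 0. ereal (real_of_rat p) \<le> ?Q t"
        by (simp add: not_frequently not_less)
      then show False using Liminf_bounded pq(1) by (metis not_less)
    qed
    moreover have "\<exists>\<^sub>F t in at 0. real_of_rat q < Q t"
    proof (rule ccontr)
      assume "\<not> ?thesis"
      then have "\<forall>\<^sub>F t in at 0. ?Q t \<le> ereal (real_of_rat q)"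
        by (simp add: not_frequently not_less)
      then show False using Limsup_bounded pq(3) by (metis not_less)
    qed
    ultimately have "oscillates F e (real_of_rat p) (real_of_rat q) x"
      by (simp add: oscillates_def Q_def)
    with no_osc[of "real_of_rat p" "real_of_rat q"] pq(2) show False by simp
  qed
  moreover have "Limsup (at 0) ?Q \<le> ereal M" "ereal (- M) \<le> Liminf (at 0) ?Q"
    using ev by (auto intro: Limsup_bounded Liminf_bounded)
  ultimately obtain D where "Liminf (at 0) ?Q = ereal D" "Limsup (at 0) ?Q = ereal D"
    by (cases "Limsup (at 0) ?Q") auto
  then have "((\<lambda>t. ereal (Q t)) \<longlongrightarrow> ereal D) (at 0)"
    by (subst tendsto_iff_Liminf_eq_Limsup) auto
  then show ?thesis by (auto simp: Q_def)
qed

text \<open>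
  At a porous point \<open>x\<close> a hole of radius \<open>\<eta> * norm w\<close> about \<open>x + w\<close> takes a fixed proportion out of the
  ball of radius \<open>norm w\<close> about \<open>x + w\<close>, which contains \<open>x\<close>; comparing Lebesgue measure with itself
  on such balls shows that the porous points occupy at most the fraction \<open>1 - \<eta> ^ DIM('a)\<close> of
  their own measure.
\<close>

lemma null_sets_porous:
  fixes A :: "'a::euclidean_space set"
  assumes "closed A" "0 < \<eta>" "\<eta> < 1"
  shows "{x\<in>A. \<exists>\<^sub>F w in at 0. \<eta> * norm w < infdist (x + w) A} \<in> null_sets lborel"
proof -
  let ?P = "{x\<in>A. \<exists>\<^sub>F w in at 0. \<eta> * norm w < infdist (x + w) A}"
  define S where "S n = ?P \<inter> cball 0 (real n)" for n
  define d where "d = DIM('a)"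
  have "{x. \<exists>\<^sub>F w in at 0. \<eta> * norm w < infdist (x + w) A} \<in> sets borel"
    by (intro borel_frequently_at_0 open_Collect_less continuous_intros)
  then have S: "S n \<in> sets borel" for n
    using \<open>closed A\<close> by (auto simp: S_def Collect_conj_eq)
  have "0 < \<eta> ^ d" "\<eta> ^ d \<le> 1" using assms by (auto simp: power_le_one)
  have "emeasure lborel (S n) = 0" for n
  proof (rule emeasure_eq_0_if_le_fraction[where c = "1 - \<eta> ^ d"])
    show "emeasure lborel (S n) \<le> ennreal (1 - \<eta> ^ d) * emeasure lborel (S n)"
    proof (rule Vitali_comparison)
      fix x and \<delta> :: real
      assume "x \<in> S n" "0 < \<delta>"
      then obtain w where w: "w \<noteq> 0" "norm w < \<delta>" "\<eta> * norm w < infdist (x + w) A"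
        by (auto simp: S_def frequently_at_0_iff)
      define r where "r = norm w"
      have "0 < r" using w(1) by (simp add: r_def)
      have "S n \<inter> ball (x + w) (\<eta> * r) = {}"
      proof -
        have "a \<notin> ball (x + w) (\<eta> * r)" if "a \<in> A" for a
          using infdist_le[OF that, of "x + w"] w(3) by (simp add: r_def dist_commute)
        then show ?thesis by (auto simp: S_def)
      qed
      then have "emeasure lborel (S n \<inter> cball (x + w) r) \<le>
          emeasure lborel (cball (x + w) r - ball (x + w) (\<eta> * r))"
        by (intro emeasure_mono) auto
      also have "\<dots> = emeasure lborel (cball (x + w) r) - emeasure lborel (ball (x + w) (\<eta> * r))"
      proof (rule emeasure_Diff)
        have "\<eta> * r \<le> r" using assms \<open>0 < r\<close> by simp
        then show "ball (x + w) (\<eta> * r) \<subseteq> cball (x + w) r" by auto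
      qed (use emeasure_lborel_ball_finite[of "x + w" "\<eta> * r"] in auto)
      also have "\<dots> = ennreal (1 - \<eta> ^ d) * emeasure lborel (cball (x + w) r)"
        using assms \<open>0 < r\<close> \<open>\<eta> ^ d \<le> 1\<close>
        by (simp add: emeasure_ball emeasure_cball d_def ennreal_minus power_mult_distrib
            algebra_simps flip: ennreal_mult)
      finally show "\<exists>a r. 0 < r \<and> r < \<delta> \<and> x \<in> cball a r \<and>
          emeasure lborel (S n \<inter> cball a r) \<le> ennreal (1 - \<eta> ^ d) * emeasure lborel (cball a r)"
        using w \<open>0 < r\<close> by (intro exI[of _ "x + w"] exI[of _ r]) (simp add: r_def dist_norm)
    qed (use S \<open>\<eta> ^ d \<le> 1\<close> in auto)
    show "emeasure lborel (S n) \<noteq> \<infinity>"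
      using emeasure_bounded_finite[of "S n"] by (simp add: S_def bounded_Int less_top)
  qed (use S \<open>0 < \<eta> ^ d\<close> \<open>\<eta> ^ d \<le> 1\<close> in auto)
  then have "S n \<in> null_sets lborel" for n
    using S by (auto simp: null_sets_def)
  then have "(\<Union>n. S n) \<in> null_sets lborel" by (rule null_sets_UN)
  moreover have "(\<Union>n. S n) = ?P" by (auto simp: S_def real_arch_simple)
  ultimately show ?thesis by simp
qed

text \<open>
  A partial derivative at \<open>x\<close> that also governs the increments in direction \<open>e\<close> from all base points
  \<open>x + w\<close> near \<open>x\<close>.  Unlike ordinary partial derivatives, these can be added up along a path
  parallel to the axes.
\<close>

definition strong_partial_derivative ::
    "('a::real_normed_vector \<Rightarrow> real) \<Rightarrow> 'a \<Rightarrow> 'a \<Rightarrow> real \<Rightarrow> bool" where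
  "strong_partial_derivative F x e D \<longleftrightarrow> (\<forall>\<epsilon>>0. \<exists>\<delta>>0. \<forall>w t. norm w < \<delta> \<longrightarrow> \<bar>t\<bar> < \<delta> \<longrightarrow>
     \<bar>F (x + w + t *\<^sub>R e) - F (x + w) - t * D\<bar> \<le> \<epsilon> * (norm w + \<bar>t\<bar>))"

text \<open>
  Let \<open>A \<epsilon> \<delta> y\<close> collect the points whose increments in direction \<open>e\<close> up to length \<open>\<delta>\<close> are \<open>t y\<close> up
  to \<open>\<epsilon> \<bar>t\<bar>\<close>.  A point with a partial derivative lies in such sets for rational parameters with \<open>\<epsilon>\<close>
  arbitrarily small, and
  almost every such point is a porous point of none of them.  Then \<open>x + w\<close> has a neighbour in \<open>A \<epsilon> \<delta> y\<close> at
  distance at most \<open>\<eta> \<parallel>w\<parallel>\<close>, and the Lipschitz bound transfers its increments to \<open>x + w\<close>.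
\<close>

lemma AE_strong_partial_derivative:
  fixes F :: "'a::euclidean_space \<Rightarrow> real"
  assumes F: "L-lipschitz_on UNIV F"
  shows "AE x in lborel. \<exists>D. strong_partial_derivative F x e D"
proof -
  define A where "A \<epsilon> \<delta> y = {x. \<forall>t. \<bar>t\<bar> \<le> \<delta> \<longrightarrow> \<bar>F (x + t *\<^sub>R e) - F x - t * y\<bar> \<le> \<epsilon> * \<bar>t\<bar>}"
    for \<epsilon> \<delta> y
  have F_cont: "continuous_on UNIV F" using F by (rule lipschitz_on_continuous_on)
  have closed: "closed (A \<epsilon> \<delta> y)" for \<epsilon> \<delta> y
  proof -
    have "A \<epsilon> \<delta> y = (\<Inter>t\<in>{t. \<bar>t\<bar> \<le> \<delta>}. {x. \<bar>F (x + t *\<^sub>R e) - F x - t * y\<bar> \<le> \<epsilon> * \<bar>t\<bar>})"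
      by (auto simp: A_def)
    also have "closed \<dots>"
      by (intro closed_INT ballI closed_Collect_le continuous_intros
          continuous_on_compose2[OF F_cont]) auto
    finally show ?thesis .
  qed
  have "0 \<le> L" using F by (rule lipschitz_on_nonneg)
  have osc: "AE x in lborel. \<forall>p\<in>\<rat>. \<forall>q\<in>\<rat>. p < q \<longrightarrow> \<not> oscillates F e p q x"
    using AE_not_in[OF null_sets_oscillates[OF F]]
    by (auto simp: AE_ball_countable countable_rat)
  have por: "AE x in lborel. \<forall>\<epsilon>\<in>\<rat>. \<forall>\<delta>\<in>\<rat>. \<forall>y\<in>\<rat>. \<forall>\<eta>\<in>\<rat>. 0 < \<eta> \<longrightarrow> \<eta> < 1 \<longrightarrow> x \<in> A \<epsilon> \<delta> y \<longrightarrow>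
      \<not> (\<exists>\<^sub>F w in at 0. \<eta> * norm w < infdist (x + w) (A \<epsilon> \<delta> y))"
    using AE_not_in[OF null_sets_porous[OF closed]]
    by (auto simp: AE_ball_countable countable_rat)
  show ?thesis
    using osc por
  proof eventually_elim
    case (elim x)
    obtain D where D: "((\<lambda>t. (F (x + t *\<^sub>R e) - F x) / t) \<longlongrightarrow> D) (at 0)"
      using convergent_if_no_oscillation[OF F, of e x] elim(1) by blast
    have "\<exists>\<delta>>0. \<forall>w t. norm w < \<delta> \<longrightarrow> \<bar>t\<bar> < \<delta> \<longrightarrow>
        \<bar>F (x + w + t *\<^sub>R e) - F (x + w) - t * D\<bar> \<le> \<epsilon> * (norm w + \<bar>t\<bar>)" if "0 < \<epsilon>" for \<epsilon>
    proof -
      obtain \<epsilon>' where \<epsilon>': "\<epsilon>' \<in> \<rat>" "0 < \<epsilon>'" "\<epsilon>' < \<epsilon> / 2"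
        using Rats_dense_in_real[of 0 "\<epsilon> / 2"] \<open>0 < \<epsilon>\<close> by auto
      obtain y where y: "y \<in> \<rat>" "D < y" "y < D + \<epsilon>' / 2"
        using Rats_dense_in_real[of D "D + \<epsilon>' / 2"] \<epsilon>' by auto
      \<comment> \<open>Moving both end points to the neighbour costs \<open>2 L \<eta> \<parallel>w\<parallel>\<close>; the remaining error is \<open>\<epsilon>' \<bar>t\<bar>\<close> plus \<open>\<bar>y - D\<bar> \<bar>t\<bar>\<close>.\<close>
      obtain \<eta> where \<eta>: "\<eta> \<in> \<rat>" "0 < \<eta>" "\<eta> < min 1 (\<epsilon> / (2 * L + 1))"
        using Rats_dense_in_real[of 0 "min 1 (\<epsilon> / (2 * L + 1))"] \<open>0 < \<epsilon>\<close> \<open>0 \<le> L\<close> by auto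
      have "\<eta> * (2 * L + 1) < \<epsilon>" using \<eta>(3) \<open>0 \<le> L\<close> by (simp add: pos_less_divide_eq)
      then have L\<eta>: "2 * L * \<eta> \<le> \<epsilon>" using \<eta>(2) by (simp add: algebra_simps)
      obtain d where d: "0 < d"
          "\<And>t. t \<noteq> 0 \<Longrightarrow> \<bar>t\<bar> < d \<Longrightarrow> \<bar>(F (x + t *\<^sub>R e) - F x) / t - D\<bar> < \<epsilon>' / 2"
        using tendstoD[OF D, of "\<epsilon>' / 2"] \<epsilon>'(2) by (auto simp: eventually_at dist_real_def)
      obtain \<delta> where \<delta>: "\<delta> \<in> \<rat>" "0 < \<delta>" "\<delta> < d"
        using Rats_dense_in_real[of 0 d] d by auto
      have "\<bar>F (x + t *\<^sub>R e) - F x - t * y\<bar> \<le> \<epsilon>' * \<bar>t\<bar>" if "\<bar>t\<bar> \<le> \<delta>" for t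
      proof (cases "t = 0")
        case False
        have "\<bar>(F (x + t *\<^sub>R e) - F x) / t - y\<bar> \<le> \<epsilon>'"
          using d(2)[OF False] \<delta> that y by linarith
        then have "\<bar>(F (x + t *\<^sub>R e) - F x) / t - y\<bar> * \<bar>t\<bar> \<le> \<epsilon>' * \<bar>t\<bar>"
          by (rule mult_right_mono) simp
        moreover have "F (x + t *\<^sub>R e) - F x - t * y = ((F (x + t *\<^sub>R e) - F x) / t - y) * t"
          using False by (simp add: field_simps)
        ultimately show ?thesis by (simp only: abs_mult)
      qed simp
      then have x: "x \<in> A \<epsilon>' \<delta> y" by (simp add: A_def)
      have "\<forall>\<^sub>F w in at 0. infdist (x + w) (A \<epsilon>' \<delta> y) \<le> \<eta> * norm w"
        using elim(2)[rule_format, OF \<epsilon>'(1) \<delta>(1) y(1) \<eta>(1,2) _ x] \<eta>(3)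
        by (simp add: not_frequently not_less)
      then obtain \<delta>' where \<delta>': "0 < \<delta>'"
          "\<And>w. w \<noteq> 0 \<Longrightarrow> norm w < \<delta>' \<Longrightarrow> infdist (x + w) (A \<epsilon>' \<delta> y) \<le> \<eta> * norm w"
        by (auto simp: eventually_at)
      show ?thesis
      proof (intro exI[of _ "min \<delta> \<delta>'"] conjI allI impI)
        fix w :: 'a and t :: real assume w: "norm w < min \<delta> \<delta>'" and t: "\<bar>t\<bar> < min \<delta> \<delta>'"
        have "infdist (x + w) (A \<epsilon>' \<delta> y) \<le> \<eta> * norm w"
          using \<delta>'(2)[of w] w x by (cases "w = 0") auto
        moreover obtain a where a: "a \<in> A \<epsilon>' \<delta> y" "infdist (x + w) (A \<epsilon>' \<delta> y) = dist (x + w) a"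
          using infdist_attains_inf[OF closed, of \<epsilon>' \<delta> y "x + w"] x by blast
        ultimately have near: "norm (x + w - a) \<le> \<eta> * norm w" by (simp add: dist_norm)
        have "\<bar>F (x + w) - F a\<bar> \<le> L * norm (x + w - a)"
          using lipschitz_on_normD[OF F, of "x + w" a] by simp
        moreover have "\<bar>F (x + w + t *\<^sub>R e) - F (a + t *\<^sub>R e)\<bar> \<le> L * norm (x + w - a)"
          using lipschitz_on_normD[OF F, of "x + w + t *\<^sub>R e" "a + t *\<^sub>R e"] by simp
        moreover have "L * norm (x + w - a) \<le> L * (\<eta> * norm w)"
          using near \<open>0 \<le> L\<close> by (rule mult_left_mono)
        moreover have "\<bar>F (a + t *\<^sub>R e) - F a - t * y\<bar> \<le> \<epsilon>' * \<bar>t\<bar>"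
          using a(1) t by (simp add: A_def)
        moreover have "\<bar>t * y - t * D\<bar> \<le> \<epsilon>' / 2 * \<bar>t\<bar>"
        proof -
          have "\<bar>t * y - t * D\<bar> = \<bar>y - D\<bar> * \<bar>t\<bar>"
            by (simp add: algebra_simps flip: abs_mult)
          also have "\<dots> \<le> \<epsilon>' / 2 * \<bar>t\<bar>"
            using y by (intro mult_right_mono) auto
          finally show ?thesis .
        qed
        moreover have "2 * L * \<eta> * norm w \<le> \<epsilon> * norm w"
          using L\<eta> by (rule mult_right_mono) simp
        moreover have "\<epsilon>' * \<bar>t\<bar> + \<epsilon>' / 2 * \<bar>t\<bar> \<le> \<epsilon> * \<bar>t\<bar>"
          using \<epsilon>' mult_right_mono[of "\<epsilon>' + \<epsilon>' / 2" \<epsilon> "\<bar>t\<bar>"] by (simp add: algebra_simps)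
        ultimately show "\<bar>F (x + w + t *\<^sub>R e) - F (x + w) - t * D\<bar> \<le> \<epsilon> * (norm w + \<bar>t\<bar>)"
          unfolding distrib_left by (simp only: mult.assoc) linarith
      qed (use \<delta> \<delta>' in simp)
    qed
    then show ?case unfolding strong_partial_derivative_def by blast
  qed
qed

lemma differentiable_if_strong_partial_derivatives:
  fixes F :: "'a::euclidean_space \<Rightarrow> real"
  assumes "\<And>e. e \<in> Basis \<Longrightarrow> \<exists>D. strong_partial_derivative F x e D"
  shows "F differentiable (at x)"
proof -
  obtain D where D: "\<And>e. e \<in> Basis \<Longrightarrow> strong_partial_derivative F x e (D e)"
    using assms by metis
  \<comment> \<open>Walk from \<open>x\<close> to \<open>x + h\<close> one axis at a time; the corners stay within a multiple of \<open>norm h\<close> of \<open>x\<close>.\<close>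
  have partial_sum: "\<exists>\<delta>>0. \<forall>h. norm h < \<delta> \<longrightarrow>
      \<bar>F (x + (\<Sum>e\<in>B. (h \<bullet> e) *\<^sub>R e)) - F x - (\<Sum>e\<in>B. (h \<bullet> e) * D e)\<bar> \<le> \<epsilon> * norm h"
    if "finite B" "B \<subseteq> Basis" "0 < \<epsilon>" for B \<epsilon>
    using that
  proof (induction B arbitrary: \<epsilon> rule: finite_induct)
    case empty
    then show ?case by (auto intro!: exI[of _ 1])
  next
    case (insert b B)
    define c where "c = real (card B) + 1"
    have "0 < c" by (simp add: c_def)
    obtain \<delta>1 where \<delta>1: "0 < \<delta>1" "\<And>w t. norm w < \<delta>1 \<Longrightarrow> \<bar>t\<bar> < \<delta>1 \<Longrightarrow>
        \<bar>F (x + w + t *\<^sub>R b) - F (x + w) - t * D b\<bar> \<le> \<epsilon> / (2 * c) * (norm w + \<bar>t\<bar>)"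
      using D[of b] insert.prems \<open>0 < c\<close> unfolding strong_partial_derivative_def
      by (metis insert_subset divide_pos_pos mult_pos_pos zero_less_numeral)
    obtain \<delta>2 where \<delta>2: "0 < \<delta>2" "\<And>h. norm h < \<delta>2 \<Longrightarrow>
        \<bar>F (x + (\<Sum>e\<in>B. (h \<bullet> e) *\<^sub>R e)) - F x - (\<Sum>e\<in>B. (h \<bullet> e) * D e)\<bar> \<le> \<epsilon> / 2 * norm h"
      using insert.IH[of "\<epsilon> / 2"] insert.prems by auto
    show ?case
    proof (intro exI[of _ "min (\<delta>1 / c) \<delta>2"] conjI allI impI)
      show "0 < min (\<delta>1 / c) \<delta>2" using \<delta>1(1) \<delta>2(1) \<open>0 < c\<close> by simp
      fix h :: 'a assume h: "norm h < min (\<delta>1 / c) \<delta>2"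
      define w where "w = (\<Sum>e\<in>B. (h \<bullet> e) *\<^sub>R e)"
      have "norm w \<le> (\<Sum>e\<in>B. norm h)"
        unfolding w_def using insert.prems Basis_le_norm[of _ h]
        by (intro sum_norm_le) (auto simp: norm_Basis)
      then have w: "norm w \<le> (c - 1) * norm h" by (simp add: c_def)
      have t: "\<bar>h \<bullet> b\<bar> \<le> norm h" using insert.prems by (auto intro: Basis_le_norm)
      have "c * norm h < \<delta>1" using h \<open>0 < c\<close> by (simp add: field_simps)
      moreover have "norm w \<le> c * norm h"
        using w norm_ge_zero[of h] unfolding left_diff_distrib by linarith
      moreover have "norm h \<le> c * norm h"
        by (simp add: c_def algebra_simps)
      ultimately have "\<bar>F (x + w + (h \<bullet> b) *\<^sub>R b) - F (x + w) - (h \<bullet> b) * D b\<bar>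
          \<le> \<epsilon> / (2 * c) * (norm w + \<bar>h \<bullet> b\<bar>)"
        using t by (intro \<delta>1(2)) auto
      also have "\<dots> \<le> \<epsilon> / (2 * c) * (c * norm h)"
        using w t \<open>0 < \<epsilon>\<close> \<open>0 < c\<close> by (intro mult_left_mono) (auto simp: algebra_simps)
      also have "\<dots> = \<epsilon> / 2 * norm h" using \<open>0 < c\<close> by simp
      finally have "\<bar>F (x + w + (h \<bullet> b) *\<^sub>R b) - F (x + w) - (h \<bullet> b) * D b\<bar> \<le> \<epsilon> / 2 * norm h" .
      moreover have "\<bar>F (x + w) - F x - (\<Sum>e\<in>B. (h \<bullet> e) * D e)\<bar> \<le> \<epsilon> / 2 * norm h"
        using \<delta>2(2)[of h] h by (simp add: w_def)
      moreover have "x + (\<Sum>e\<in>insert b B. (h \<bullet> e) *\<^sub>R e) = x + w + (h \<bullet> b) *\<^sub>R b"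
        using insert.hyps by (simp add: w_def add_ac)
      moreover have "(\<Sum>e\<in>insert b B. (h \<bullet> e) * D e) = (h \<bullet> b) * D b + (\<Sum>e\<in>B. (h \<bullet> e) * D e)"
        using insert.hyps by simp
      ultimately show "\<bar>F (x + (\<Sum>e\<in>insert b B. (h \<bullet> e) *\<^sub>R e)) - F x
          - (\<Sum>e\<in>insert b B. (h \<bullet> e) * D e)\<bar> \<le> \<epsilon> * norm h"
        by (simp only:)
    qed
  qed
  have "(F has_derivative (\<lambda>h. \<Sum>e\<in>Basis. (h \<bullet> e) * D e)) (at x)"
    unfolding has_derivative_at_alt
  proof (intro conjI allI impI)
    show "bounded_linear (\<lambda>h. \<Sum>e\<in>Basis. (h \<bullet> e) * D e)"
      by (intro bounded_linear_sum bounded_linear_mult_const bounded_linear_inner_left)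
    fix \<epsilon> :: real assume "0 < \<epsilon>"
    then obtain \<delta> where "0 < \<delta>" and \<delta>: "\<And>h. norm h < \<delta> \<Longrightarrow>
        \<bar>F (x + h) - F x - (\<Sum>e\<in>Basis. (h \<bullet> e) * D e)\<bar> \<le> \<epsilon> * norm h"
      using partial_sum[OF finite_Basis subset_refl \<open>0 < \<epsilon>\<close>]
      unfolding euclidean_representation by blast
    show "\<exists>\<delta>>0. \<forall>y. norm (y - x) < \<delta> \<longrightarrow>
        norm (F y - F x - (\<Sum>e\<in>Basis. (y - x) \<bullet> e * D e)) \<le> \<epsilon> * norm (y - x)"
    proof (intro exI[of _ \<delta>] conjI allI impI)
      fix y assume "norm (y - x) < \<delta>"
      from \<delta>[OF this] show "norm (F y - F x - (\<Sum>e\<in>Basis. (y - x) \<bullet> e * D e)) \<le> \<epsilon> * norm (y - x)"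
        by simp
    qed fact
  qed
  then show ?thesis by (rule differentiableI)
qed

theorem Rademacher:
  fixes F :: "'a::euclidean_space \<Rightarrow> 'b::euclidean_space"
  assumes F: "L-lipschitz_on UNIV F"
  shows "AE x in lebesgue. F differentiable (at x)"
proof -
  have component: "AE x in lborel. (\<lambda>y. F y \<bullet> i) differentiable (at x)" if "i \<in> Basis" for i
  proof -
    have "L-lipschitz_on UNIV (\<lambda>y. F y \<bullet> i)"
    proof (rule lipschitz_onI)
      fix x y
      have "dist (F x \<bullet> i) (F y \<bullet> i) \<le> dist (F x) (F y)"
        using Basis_le_norm[OF that, of "F x - F y"] by (simp add: dist_norm inner_diff_left)
      also have "\<dots> \<le> L * dist x y" using F by (rule lipschitz_onD) auto
      finally show "dist (F x \<bullet> i) (F y \<bullet> i) \<le> L * dist x y" .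
    qed (rule lipschitz_on_nonneg[OF F])
    then have "AE x in lborel. \<forall>e\<in>Basis. \<exists>D. strong_partial_derivative (\<lambda>y. F y \<bullet> i) x e D"
      by (subst AE_ball_countable) (auto intro: AE_strong_partial_derivative countable_finite)
    then show ?thesis
      by eventually_elim (auto intro: differentiable_if_strong_partial_derivatives)
  qed
  then have "AE x in lborel. \<forall>i\<in>Basis. (\<lambda>y. F y \<bullet> i) differentiable (at x)"
    by (subst AE_ball_countable) (auto intro: countable_finite)
  then have "AE x in lborel. F differentiable (at x)"
    by eventually_elim (metis differentiable_componentwise_within)
  then show ?thesis by (rule AE_completion)
qed

section \<open>The proximal operator\<close>

lemma nonpos_if_le_multiple:
  fixes a B :: real
  assumes "\<And>t. 0 < t \<Longrightarrow> t < 1 \<Longrightarrow> a \<le> t * B"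
  shows "a \<le> 0"
proof (rule tendsto_lowerbound)
  show "((\<lambda>t. t * B) \<longlongrightarrow> 0) (at_right 0)"
    by (auto intro!: tendsto_eq_intros)
  show "\<forall>\<^sub>F t in at_right 0. a \<le> t * B"
    using assms by (auto simp: eventually_at_right_field intro!: exI[of _ 1])
qed simp

text \<open>
  A hyperplane separating the epigraph from a point \<open>(x0, r0 - 1)\<close> strictly below its boundary is not
  vertical, because \<open>(x0, r0)\<close> lies above it; hence it is the graph of an affine minorant.
\<close>

lemma ccp_affine_minorant:
  assumes "ccp g"
  obtains a c where "\<And>z t. g z \<le> ereal t \<Longrightarrow> a \<bullet> z + c \<le> t"
proof -
  obtain x0 where "g x0 \<noteq> \<infinity>" "g x0 \<noteq> -\<infinity>" using assms by (auto simp: ccp_def)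
  then obtain r0 where r0: "g x0 = ereal r0" by (cases "g x0") auto
  have "(x0, r0 - 1) \<notin> ereal_epigraph g" by (simp add: ereal_epigraph_def r0)
  then obtain u b where sep: "u \<bullet> (x0, r0 - 1) < b" "\<And>e. e \<in> ereal_epigraph g \<Longrightarrow> b < u \<bullet> e"
    using separating_hyperplane_closed_point[of "ereal_epigraph g"] assms
    unfolding ccp_def by blast
  obtain v \<beta> where u: "u = (v, \<beta>)" by (cases u)
  have above: "b < v \<bullet> z + \<beta> * t" if "g z \<le> ereal t" for z t
    using sep(2)[of "(z, t)"] that by (simp add: u ereal_epigraph_def)
  have "0 < \<beta>"
    using sep(1) above[of x0 r0] by (simp add: u r0 algebra_simps)
  show ?thesis
  proof
    show "(- (1 / \<beta>) *\<^sub>R v) \<bullet> z + b / \<beta> \<le> t" if "g z \<le> ereal t" for z t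
      using above[OF that] \<open>0 < \<beta>\<close> by (simp add: field_simps)
  qed
qed

text \<open>
  Existence of the minimiser.  Over the closed epigraph the objective is the continuous function
  \<open>\<phi> (z, t) = t + \<parallel>x - z\<parallel>\<^sup>2 / (2 \<gamma>)\<close>; the quadratic term beats the affine minorant, so sublevel
  sets are bounded and the minimum is attained.  The bound is stated for all \<open>t\<close> above \<open>g z\<close>, which
  keeps extended reals out of later computations.
\<close>

lemma prox_minimizes:
  fixes g :: "'a::euclidean_space \<Rightarrow> ereal"
  assumes g: "ccp g" and "0 < \<gamma>"
  obtains r where "g (prox \<gamma> g x) = ereal r"
    and "\<forall>z t. g z \<le> ereal t \<longrightarrow>
      r + 1 / (2 * \<gamma>) * (norm (x - prox \<gamma> g x))\<^sup>2 \<le> t + 1 / (2 * \<gamma>) * (norm (x - z))\<^sup>2"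
proof -
  define E where "E = ereal_epigraph g"
  define \<phi> where "\<phi> e = snd e + 1 / (2 * \<gamma>) * (norm (x - fst e))\<^sup>2" for e :: "'a \<times> real"
  have E: "closed E" "\<And>z t. (z, t) \<in> E \<longleftrightarrow> g z \<le> ereal t"
    using g by (auto simp: E_def ccp_def ereal_epigraph_def)
  have minus_inf: "g z \<noteq> -\<infinity>" for z using g by (simp add: ccp_def)
  obtain x0 where "g x0 \<noteq> \<infinity>" using g by (auto simp: ccp_def)
  then obtain r0 where r0: "g x0 = ereal r0" using minus_inf[of x0] by (cases "g x0") auto
  obtain a c where ac: "\<And>z t. g z \<le> ereal t \<Longrightarrow> a \<bullet> z + c \<le> t"
    using ccp_affine_minorant[OF g] by blast
  define v where "v = \<phi> (x0, r0)"
  define S where "S = E \<inter> {e. \<phi> e \<le> v}"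
  define K where "K = v - c - a \<bullet> x"
  define R where "R = 1 + 2 * \<gamma> * (\<bar>K\<bar> + norm a)"
  have cont: "continuous_on UNIV \<phi>"
    unfolding \<phi>_def by (intro continuous_intros)
  have bound: "e \<in> cball x R \<times> {a \<bullet> x + c - norm a * R..v}" if "e \<in> S" for e
  proof -
    obtain z t where e: "e = (z, t)" by (cases e)
    define s where "s = norm (x - z)"
    have "a \<bullet> z + c \<le> t" and tv: "t + s\<^sup>2 / (2 * \<gamma>) \<le> v"
      using that ac by (auto simp: S_def E e \<phi>_def s_def)
    have "a \<bullet> (x - z) \<le> norm a * s" unfolding s_def by (rule norm_cauchy_schwarz)
    then have az: "a \<bullet> x - norm a * s \<le> a \<bullet> z" by (simp add: inner_diff_right)
    have "0 \<le> s" by (simp add: s_def)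
    have "s\<^sup>2 / (2 * \<gamma>) \<le> K + norm a * s"
      using tv \<open>a \<bullet> z + c \<le> t\<close> az by (simp add: K_def)
    then have "s\<^sup>2 \<le> (K + norm a * s) * (2 * \<gamma>)"
      using \<open>0 < \<gamma>\<close> by (subst (asm) pos_divide_le_eq) auto
    then have s2: "s * s \<le> 2 * \<gamma> * (K + norm a * s)"
      by (simp add: power2_eq_square mult.commute)
    have "s \<le> R"
    proof (cases "s \<le> 1")
      case True
      have "0 \<le> 2 * \<gamma> * (\<bar>K\<bar> + norm a)" using \<open>0 < \<gamma>\<close> by simp
      with True show ?thesis unfolding R_def by linarith
    next
      case False
      have "K \<le> \<bar>K\<bar> * s" using False mult_left_mono[of 1 s "\<bar>K\<bar>"] by simp
      then have "2 * \<gamma> * (K + norm a * s) \<le> 2 * \<gamma> * ((\<bar>K\<bar> + norm a) * s)"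
        using \<open>0 < \<gamma>\<close> by (intro mult_left_mono) (auto simp: algebra_simps)
      with s2 have "s * s \<le> 2 * \<gamma> * (\<bar>K\<bar> + norm a) * s" by (simp add: mult.assoc)
      with False have "s \<le> 2 * \<gamma> * (\<bar>K\<bar> + norm a)" by simp
      then show ?thesis by (simp add: R_def)
    qed
    moreover have "norm a * s \<le> norm a * R" using \<open>s \<le> R\<close> by (intro mult_left_mono) auto
    moreover have "0 \<le> s\<^sup>2 / (2 * \<gamma>)" using \<open>0 < \<gamma>\<close> by simp
    ultimately show ?thesis
      using tv az \<open>a \<bullet> z + c \<le> t\<close> by (auto simp: e s_def dist_norm)
  qed
  have "closed S"
    unfolding S_def by (intro closed_Int E(1) closed_Collect_le cont continuous_on_const)
  then have "compact (cball x R \<times> {a \<bullet> x + c - norm a * R..v} \<inter> S)"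
    by (intro compact_Int_closed compact_Times) auto
  moreover have "cball x R \<times> {a \<bullet> x + c - norm a * R..v} \<inter> S = S"
    using bound by blast
  ultimately have "compact S" by simp
  moreover have x0: "(x0, r0) \<in> S" by (simp add: S_def E r0 v_def)
  ultimately obtain e where e: "e \<in> S" "\<And>e'. e' \<in> S \<Longrightarrow> \<phi> e \<le> \<phi> e'"
    using continuous_attains_inf[of S \<phi>] continuous_on_subset[OF cont] by blast
  have e_min: "\<phi> e \<le> \<phi> e'" if "e' \<in> E" for e'
    using e that by (cases "\<phi> e' \<le> v") (auto simp: S_def)
  obtain y t where yt: "e = (y, t)" by (cases e)
  define G where "G z = g z + ereal (1 / (2 * \<gamma>) * (norm (x - z))\<^sup>2)" for z
  have "G y \<le> G z" for z
  proof (cases "g z")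
    case (real r)
    then have "\<phi> e \<le> \<phi> (z, r)" by (intro e_min) (simp add: E)
    then have "ereal t + ereal (1 / (2 * \<gamma>) * (norm (x - y))\<^sup>2) \<le> G z"
      by (simp add: G_def real \<phi>_def yt)
    moreover have "G y \<le> ereal t + ereal (1 / (2 * \<gamma>) * (norm (x - y))\<^sup>2)"
      unfolding G_def using e(1) by (intro add_right_mono) (simp add: S_def E yt)
    ultimately show ?thesis by (rule order_trans[rotated])
  qed (use minus_inf in \<open>auto simp: G_def\<close>)
  then have "is_arg_min G (\<lambda>_. True) y" by (simp add: is_arg_min_def not_less)
  then have "is_arg_min G (\<lambda>_. True) (prox \<gamma> g x)"
    unfolding prox_def arg_min_def G_def by (rule someI)
  then have prox_min: "G (prox \<gamma> g x) \<le> G z" for z by (simp add: is_arg_min_def not_less)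
  then have "G (prox \<gamma> g x) \<le> G x0" .
  then have "g (prox \<gamma> g x) \<noteq> \<infinity>" by (auto simp: G_def r0)
  then obtain r where r: "g (prox \<gamma> g x) = ereal r"
    using minus_inf[of "prox \<gamma> g x"] by (cases "g (prox \<gamma> g x)") auto
  show ?thesis
  proof
    show "g (prox \<gamma> g x) = ereal r" by fact
  next
    have "r + 1 / (2 * \<gamma>) * (norm (x - prox \<gamma> g x))\<^sup>2 \<le> t + 1 / (2 * \<gamma>) * (norm (x - z))\<^sup>2"
      if "g z \<le> ereal t" for z t
    proof -
      have "G (prox \<gamma> g x) \<le> G z" by (rule prox_min)
      also have "G z \<le> ereal t + ereal (1 / (2 * \<gamma>) * (norm (x - z))\<^sup>2)"
        unfolding G_def using \<open>g z \<le> ereal t\<close> by (rule add_right_mono)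
      finally show ?thesis by (simp add: G_def r)
    qed
    then show "\<forall>z t. g z \<le> ereal t \<longrightarrow>
        r + 1 / (2 * \<gamma>) * (norm (x - prox \<gamma> g x))\<^sup>2 \<le> t + 1 / (2 * \<gamma>) * (norm (x - z))\<^sup>2"
      by blast
  qed
qed

text \<open>
  Compare the minimiser \<open>y\<close> with \<open>y + \<tau> (z - y)\<close>: convexity bounds \<open>g\<close> along the segment, and dividing
  the difference of the objectives by \<open>\<tau>\<close> leaves the claim up to a term of order \<open>\<tau>\<close>.
\<close>

lemma prox_variational_inequality:
  fixes g :: "'a::euclidean_space \<Rightarrow> ereal"
  assumes g: "ccp g" and "0 < \<gamma>"
  obtains r where "g (prox \<gamma> g x) = ereal r"
    and "\<forall>z t. g z \<le> ereal t \<longrightarrow> (x - prox \<gamma> g x) \<bullet> (z - prox \<gamma> g x) \<le> \<gamma> * (t - r)"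
proof -
  define y where "y = prox \<gamma> g x"
  obtain r where r: "g y = ereal r" and min: "\<forall>z t. g z \<le> ereal t \<longrightarrow>
      r + 1 / (2 * \<gamma>) * (norm (x - y))\<^sup>2 \<le> t + 1 / (2 * \<gamma>) * (norm (x - z))\<^sup>2"
    unfolding y_def by (rule prox_minimizes[OF assms, of x])
  have "(x - y) \<bullet> (z - y) \<le> \<gamma> * (t - r)" if "g z \<le> ereal t" for z t
  proof -
    have "(x - y) \<bullet> (z - y) - \<gamma> * (t - r) \<le> \<tau> * ((norm (z - y))\<^sup>2 / 2)" if "0 < \<tau>" "\<tau> < 1" for \<tau>
    proof -
      have "(1 - \<tau>) *\<^sub>R (y, r) + \<tau> *\<^sub>R (z, t) \<in> ereal_epigraph g"
        using g \<open>0 < \<tau>\<close> \<open>\<tau> < 1\<close> r \<open>g z \<le> ereal t\<close> unfolding ccp_def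
        by (intro convexD_alt) (auto simp: ereal_epigraph_def)
      moreover have "(1 - \<tau>) *\<^sub>R y + \<tau> *\<^sub>R z = y + \<tau> *\<^sub>R (z - y)"
        by (simp add: algebra_simps)
      ultimately have "g (y + \<tau> *\<^sub>R (z - y)) \<le> ereal ((1 - \<tau>) * r + \<tau> * t)"
        by (simp add: ereal_epigraph_def)
      define c N X where "c = 1 / (2 * \<gamma>)" and "N = (norm (z - y))\<^sup>2" and "X = (x - y) \<bullet> (z - y)"
      have c: "2 * \<gamma> * c = 1" using \<open>0 < \<gamma>\<close> by (simp add: c_def)
      have expand: "(norm (x - (y + \<tau> *\<^sub>R (z - y))))\<^sup>2 = (norm (x - y))\<^sup>2 - 2 * \<tau> * X + \<tau>\<^sup>2 * N"
        unfolding diff_diff_eq[symmetric] power2_norm_eq_inner X_def N_def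
        by (simp only: inner_diff_left[of "x - y"] inner_diff_right[of _ "x - y"]
            inner_scaleR_left inner_scaleR_right inner_commute[of "z - y" "x - y"])
          (simp add: power2_eq_square right_diff_distrib)
      have "0 \<le> \<tau> * (t - r) + c * (\<tau>\<^sup>2 * N - 2 * \<tau> * X)"
        using min[rule_format, OF \<open>g (y + _) \<le> _\<close>, folded c_def] unfolding expand
        by (simp add: algebra_simps)
      then have "0 \<le> 2 * \<gamma> * (\<tau> * (t - r) + c * (\<tau>\<^sup>2 * N - 2 * \<tau> * X))"
        using \<open>0 < \<gamma>\<close> by simp
      also have "\<dots> = 2 * \<gamma> * (\<tau> * (t - r)) + 2 * \<gamma> * c * (\<tau>\<^sup>2 * N - 2 * \<tau> * X)"
        by (simp only: distrib_left mult.assoc)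
      finally have "\<tau> * (X - \<gamma> * (t - r)) \<le> \<tau> * (\<tau> * (N / 2))"
        unfolding c by (simp add: algebra_simps power2_eq_square)
      then have "X - \<gamma> * (t - r) \<le> \<tau> * (N / 2)" using \<open>0 < \<tau>\<close> by simp
      then show ?thesis by (simp only: X_def N_def)
    qed
    then have "(x - y) \<bullet> (z - y) - \<gamma> * (t - r) \<le> 0" by (rule nonpos_if_le_multiple)
    then show ?thesis by simp
  qed
  with r show ?thesis unfolding y_def by (intro that) auto
qed

text \<open>
  Add the variational inequalities at \<open>u\<close> and at \<open>v\<close>, each tested with the other proximal point; the
  values of \<open>g\<close> cancel.
\<close>

lemma prox_firmly_nonexpansive:
  fixes g :: "'a::euclidean_space \<Rightarrow> ereal"
  assumes "ccp g" "0 < \<gamma>"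
  shows "(norm (prox \<gamma> g u - prox \<gamma> g v))\<^sup>2 \<le> (prox \<gamma> g u - prox \<gamma> g v) \<bullet> (u - v)"
proof -
  obtain r where r: "g (prox \<gamma> g u) = ereal r"
      "\<forall>z t. g z \<le> ereal t \<longrightarrow> (u - prox \<gamma> g u) \<bullet> (z - prox \<gamma> g u) \<le> \<gamma> * (t - r)"
    by (rule prox_variational_inequality[OF assms, of u])
  obtain s where s: "g (prox \<gamma> g v) = ereal s"
      "\<forall>z t. g z \<le> ereal t \<longrightarrow> (v - prox \<gamma> g v) \<bullet> (z - prox \<gamma> g v) \<le> \<gamma> * (t - s)"
    by (rule prox_variational_inequality[OF assms, of v])
  have "(u - prox \<gamma> g u) \<bullet> (prox \<gamma> g v - prox \<gamma> g u) + (v - prox \<gamma> g v) \<bullet> (prox \<gamma> g u - prox \<gamma> g v) \<le> 0"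
    using r(2)[rule_format, of "prox \<gamma> g v" s] s(2)[rule_format, of "prox \<gamma> g u" r] r(1) s(1) by (simp add: algebra_simps)
  then show ?thesis
    unfolding power2_norm_eq_inner by (simp add: algebra_simps inner_commute)
qed

lemma prox_nonexpansive:
  fixes g :: "'a::euclidean_space \<Rightarrow> ereal"
  assumes "ccp g" "0 < \<gamma>"
  shows "1-lipschitz_on UNIV (prox \<gamma> g)"
proof (rule lipschitz_onI)
  fix u v
  have "(norm (prox \<gamma> g u - prox \<gamma> g v))\<^sup>2 \<le> norm (prox \<gamma> g u - prox \<gamma> g v) * norm (u - v)"
    by (rule order_trans[OF prox_firmly_nonexpansive[OF assms] norm_cauchy_schwarz])
  then have "norm (prox \<gamma> g u - prox \<gamma> g v) \<le> norm (u - v)"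
    by (cases "prox \<gamma> g u = prox \<gamma> g v") (auto simp: power2_eq_square)
  then show "dist (prox \<gamma> g u) (prox \<gamma> g v) \<le> 1 * dist u v" by (simp add: dist_norm)
qed simp

section \<open>Gradients of strongly convex smooth functions\<close>

lemma has_derivative_gradient:
  fixes f :: "'a::euclidean_space \<Rightarrow> real"
  assumes "f differentiable (at x)"
  shows "(f has_derivative (\<lambda>h. h \<bullet> gradient f x)) (at x)"
proof -
  obtain f' where f': "(f has_derivative f') (at x)" using assms by (auto simp: differentiable_def)
  have "f' = (\<lambda>h. h \<bullet> adjoint f' 1)"
    using adjoint_works[OF has_derivative_linear[OF f'], of _ 1] by auto
  with f' have ex: "GDERIV f x :> adjoint f' 1" by (simp add: gderiv_def)
  have "GDERIV f x :> gradient f x"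
    unfolding gradient_def
  proof (rule theI[where P = "\<lambda>d. GDERIV f x :> d", OF ex])
    fix d assume "GDERIV f x :> d"
    then have "(\<lambda>h. h \<bullet> d) = (\<lambda>h. h \<bullet> adjoint f' 1)"
      using ex unfolding gderiv_def by (rule has_derivative_unique)
    then show "d = adjoint f' 1" by (simp add: fun_eq_iff vector_eq_ldot)
  qed
  then show ?thesis by (simp add: gderiv_def)
qed

lemma has_real_derivative_on_line:
  fixes f :: "'a::euclidean_space \<Rightarrow> real"
  assumes "f differentiable (at (x + t *\<^sub>R v))"
  shows "((\<lambda>t. f (x + t *\<^sub>R v)) has_real_derivative v \<bullet> gradient f (x + t *\<^sub>R v)) (at t)"
proof -
  have "((\<lambda>t. x + t *\<^sub>R v) has_derivative (\<lambda>s. s *\<^sub>R v)) (at t)"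
    by (auto intro!: derivative_eq_intros)
  from has_derivative_compose[OF this has_derivative_gradient[OF assms]]
  show ?thesis by (simp add: has_field_derivative_def o_def mult.commute[of _ "v \<bullet> _"])
qed

text \<open>
  Along the segment from \<open>x\<close> to \<open>y\<close>, the difference of both sides has a derivative that the
  Cauchy-Schwarz inequality and the Lipschitz bound on the gradient make nonpositive.
\<close>

lemma L_smooth_upper_bound:
  fixes f :: "'a::euclidean_space \<Rightarrow> real"
  assumes f: "L_smooth L f"
  shows "f y \<le> f x + gradient f x \<bullet> (y - x) + L / 2 * (norm (y - x))\<^sup>2"
proof -
  define v where "v = y - x"
  define \<phi> where "\<phi> t = f (x + t *\<^sub>R v) - t * (gradient f x \<bullet> v) - L / 2 * t\<^sup>2 * (norm v)\<^sup>2" for t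
  have diff: "f differentiable (at z)" for z using f by (simp add: L_smooth_def)
  have lip: "norm (gradient f z - gradient f x) \<le> L * norm (z - x)" for z
    using f lipschitz_on_normD unfolding L_smooth_def by blast
  have "\<phi> 1 \<le> \<phi> 0"
  proof (rule DERIV_nonpos_imp_nonincreasing[of 0 1 \<phi>])
    fix t :: real assume t: "0 \<le> t" "t \<le> 1"
    let ?D = "v \<bullet> gradient f (x + t *\<^sub>R v) - gradient f x \<bullet> v - L * t * (norm v)\<^sup>2"
    have "(\<phi> has_real_derivative ?D) (at t)"
      unfolding \<phi>_def
      by (auto intro!: derivative_eq_intros has_real_derivative_on_line diff)
    moreover have "?D \<le> 0"
    proof -
      have "v \<bullet> gradient f (x + t *\<^sub>R v) - gradient f x \<bullet> v =
          v \<bullet> (gradient f (x + t *\<^sub>R v) - gradient f x)"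
        by (simp add: inner_diff_right inner_commute)
      also have "\<dots> \<le> norm v * norm (gradient f (x + t *\<^sub>R v) - gradient f x)"
        by (rule norm_cauchy_schwarz)
      also have "\<dots> \<le> norm v * (L * norm (t *\<^sub>R v))"
        using lip[of "x + t *\<^sub>R v"] by (intro mult_left_mono) auto
      also have "\<dots> = L * t * (norm v)\<^sup>2" using t by (simp add: power2_eq_square)
      finally show ?thesis by simp
    qed
    ultimately show "\<exists>D. (\<phi> has_real_derivative D) (at t) \<and> D \<le> 0" by blast
  qed simp
  then show ?thesis by (simp add: \<phi>_def v_def)
qed

lemma strongly_convex_lower_bound:
  fixes f :: "'a::euclidean_space \<Rightarrow> real"
  assumes f: "strongly_convex \<rho> f" and diff: "f differentiable (at x)"
  shows "f x + gradient f x \<bullet> (y - x) + \<rho> / 2 * (norm (y - x))\<^sup>2 \<le> f y"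
proof -
  define v where "v = y - x"
  define h where "h z = f z - \<rho> / 2 * (norm z)\<^sup>2" for z
  define \<psi> where "\<psi> t = h (x + t *\<^sub>R v)" for t
  have h: "convex_on UNIV h" using f by (simp add: strongly_convex_def h_def[abs_def])
  have "convex_on UNIV \<psi>"
  proof (rule convex_onI)
    fix t s r :: real assume "0 < t" "t < 1"
    have "x + ((1 - t) * s + t * r) *\<^sub>R v = (1 - t) *\<^sub>R (x + s *\<^sub>R v) + t *\<^sub>R (x + r *\<^sub>R v)"
      by (simp add: algebra_simps)
    then show "\<psi> ((1 - t) *\<^sub>R s + t *\<^sub>R r) \<le> (1 - t) * \<psi> s + t * \<psi> r"
      using convex_onD[OF h, of t "x + s *\<^sub>R v" "x + r *\<^sub>R v"] \<open>0 < t\<close> \<open>t < 1\<close>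
      by (simp add: \<psi>_def)
  qed simp
  moreover have "(\<psi> has_real_derivative v \<bullet> gradient f x - \<rho> * (x \<bullet> v)) (at 0)"
  proof -
    have "((\<lambda>t. f (x + t *\<^sub>R v)) has_real_derivative v \<bullet> gradient f x) (at 0)"
      using has_real_derivative_on_line[of f x 0 v] diff by simp
    moreover have "((\<lambda>t. \<rho> / 2 * (norm x)\<^sup>2 + \<rho> * (t * (x \<bullet> v)) + \<rho> / 2 * (t\<^sup>2 * (norm v)\<^sup>2))
        has_real_derivative \<rho> * (x \<bullet> v)) (at 0)"
      by (auto intro!: derivative_eq_intros)
    ultimately have "((\<lambda>t. f (x + t *\<^sub>R v) -
        (\<rho> / 2 * (norm x)\<^sup>2 + \<rho> * (t * (x \<bullet> v)) + \<rho> / 2 * (t\<^sup>2 * (norm v)\<^sup>2)))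
        has_real_derivative v \<bullet> gradient f x - \<rho> * (x \<bullet> v)) (at 0)"
      by (rule DERIV_diff)
    moreover have "\<psi> = (\<lambda>t. f (x + t *\<^sub>R v) -
        (\<rho> / 2 * (norm x)\<^sup>2 + \<rho> * (t * (x \<bullet> v)) + \<rho> / 2 * (t\<^sup>2 * (norm v)\<^sup>2)))"
    proof
      fix t
      have "(norm (x + t *\<^sub>R v))\<^sup>2 = (norm x)\<^sup>2 + 2 * (t * (x \<bullet> v)) + t\<^sup>2 * (norm v)\<^sup>2"
        unfolding power2_norm_eq_inner
        by (simp add: inner_add_left inner_add_right inner_commute power2_eq_square)
      then show "\<psi> t = f (x + t *\<^sub>R v) -
          (\<rho> / 2 * (norm x)\<^sup>2 + \<rho> * (t * (x \<bullet> v)) + \<rho> / 2 * (t\<^sup>2 * (norm v)\<^sup>2))"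
        unfolding \<psi>_def h_def by (simp add: distrib_left)
    qed
    ultimately show ?thesis by simp
  qed
  ultimately have "(v \<bullet> gradient f x - \<rho> * (x \<bullet> v)) * (1 - 0) \<le> \<psi> 1 - \<psi> 0"
    by (intro convex_on_imp_above_tangent[where A = UNIV]) auto
  moreover have "(norm y)\<^sup>2 = (norm x)\<^sup>2 + 2 * (x \<bullet> v) + (norm v)\<^sup>2"
    by (simp add: v_def power2_norm_eq_inner algebra_simps inner_commute)
  moreover have "\<psi> 1 = f y - \<rho> / 2 * (norm y)\<^sup>2" "\<psi> 0 = f x - \<rho> / 2 * (norm x)\<^sup>2"
    by (simp_all add: \<psi>_def h_def v_def)
  ultimately show ?thesis
    by (simp add: v_def[symmetric] inner_commute algebra_simps)
qed

text \<open>
  The Baillon-Haddad argument: compare the tangent of \<open>h\<close> at \<open>x\<close> with the upper parabola at \<open>y\<close> in the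
  point \<open>y + s d\<close>, where \<open>d = G x - G y\<close>, and symmetrically in \<open>x - s d\<close>.  The sum is a quadratic bound in the
  free step \<open>s\<close>, optimal at \<open>s = 1 / M\<close>; for \<open>M = 0\<close> let \<open>s\<close> tend to infinity.
\<close>

lemma cocoercive_if_quadratic_bounds:
  fixes h :: "'a::real_inner \<Rightarrow> real" and G :: "'a \<Rightarrow> 'a"
  assumes lower: "\<And>x y. h x + G x \<bullet> (y - x) \<le> h y"
    and upper: "\<And>x y. h y \<le> h x + G x \<bullet> (y - x) + M / 2 * (norm (y - x))\<^sup>2"
  shows "(norm (G x - G y))\<^sup>2 \<le> M * ((G x - G y) \<bullet> (x - y))"
proof (cases "x = y")
  case False
  define d where "d = G x - G y"
  have "0 \<le> M / 2 * (norm (y - x))\<^sup>2"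
    using lower[of x y] upper[of y x] by simp
  then have "0 \<le> M" using False by (simp add: zero_le_mult_iff)
  have main: "(2 * s - M * s\<^sup>2) * (norm d)\<^sup>2 \<le> d \<bullet> (x - y)" for s
  proof -
    have 1: "h x + G x \<bullet> (y + s *\<^sub>R d - x) \<le> h y + G y \<bullet> (s *\<^sub>R d) + M / 2 * (norm (s *\<^sub>R d))\<^sup>2"
      using order_trans[OF lower[of x "y + s *\<^sub>R d"] upper[of "y + s *\<^sub>R d" y]] by simp
    have 2: "h y + G y \<bullet> (x - s *\<^sub>R d - y) \<le> h x + G x \<bullet> (- (s *\<^sub>R d)) + M / 2 * (norm (s *\<^sub>R d))\<^sup>2"
      using order_trans[OF lower[of y "x - s *\<^sub>R d"] upper[of "x - s *\<^sub>R d" x]] by simp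
    have "G x \<bullet> (y + s *\<^sub>R d - x) + G y \<bullet> (x - s *\<^sub>R d - y) \<le>
        G y \<bullet> (s *\<^sub>R d) + G x \<bullet> (- (s *\<^sub>R d)) + M * (norm (s *\<^sub>R d))\<^sup>2"
      using 1 2 by simp
    moreover have "G x \<bullet> (y + s *\<^sub>R d - x) + G y \<bullet> (x - s *\<^sub>R d - y)
        - (G y \<bullet> (s *\<^sub>R d) + G x \<bullet> (- (s *\<^sub>R d))) = 2 * s * (d \<bullet> d) - d \<bullet> (x - y)"
      by (simp add: d_def inner_diff_left inner_diff_right inner_add_right algebra_simps)
    moreover have "(norm (s *\<^sub>R d))\<^sup>2 = s\<^sup>2 * (norm d)\<^sup>2"
      by (simp add: power_mult_distrib)
    ultimately show ?thesis by (simp add: power2_norm_eq_inner algebra_simps)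
  qed
  show ?thesis
  proof (cases "M = 0")
    case True
    have "(norm d)\<^sup>2 \<le> t * (d \<bullet> (x - y) / 2)" if "0 < t" for t
      using main[of "1 / t"] that True by (simp add: field_simps)
    then have "(norm d)\<^sup>2 \<le> 0" by (rule nonpos_if_le_multiple)
    then show ?thesis using True by (simp add: d_def)
  next
    case False
    with \<open>0 \<le> M\<close> have "0 < M" by simp
    then show ?thesis using main[of "1 / M"] by (simp add: d_def field_simps power2_eq_square)
  qed
qed simp

text \<open>
  The first inequality says that the difference of the gradients lies in the ball with diameter from \<open>\<rho> (x - y)\<close> to
  \<open>L (x - y)\<close>, as it would if it were a symmetric matrix with spectrum in \<open>[\<rho>, L]\<close> applied to
  \<open>x - y\<close>.  It is cocoercivity of the convex function \<open>f - \<rho>/2 \<parallel>\<cdot>\<parallel>\<^sup>2\<close>.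
\<close>

lemma gradient_difference_bounds:
  fixes f :: "'a::euclidean_space \<Rightarrow> real"
  assumes convex: "strongly_convex \<rho> f" and smooth: "L_smooth L f"
  defines "w \<equiv> \<lambda>x y. gradient f x - gradient f y"
  shows "0 \<le> (w x y - \<rho> *\<^sub>R (x - y)) \<bullet> (L *\<^sub>R (x - y) - w x y)"
    and "\<rho> * (norm (x - y))\<^sup>2 \<le> w x y \<bullet> (x - y)"
    and "x \<noteq> y \<Longrightarrow> \<rho> \<le> L"
proof -
  define h where "h z = f z - \<rho> / 2 * (norm z)\<^sup>2" for z
  define G where "G z = gradient f z - \<rho> *\<^sub>R z" for z
  have diff: "f differentiable (at z)" for z using smooth by (simp add: L_smooth_def)
  have expand: "\<rho> / 2 * (norm b)\<^sup>2 =
      \<rho> / 2 * (norm a)\<^sup>2 + \<rho> * (a \<bullet> (b - a)) + \<rho> / 2 * (norm (b - a))\<^sup>2" for a b :: 'a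
    by (simp add: power2_norm_eq_inner algebra_simps inner_commute)
  have G: "G a \<bullet> (b - a) = gradient f a \<bullet> (b - a) - \<rho> * (a \<bullet> (b - a))" for a b
    by (simp add: G_def inner_diff_left)
  have lower: "h a + G a \<bullet> (b - a) \<le> h b" for a b
    using strongly_convex_lower_bound[OF convex diff, of a b] expand[where a = a and b = b]
    unfolding h_def G by linarith
  have upper: "h b \<le> h a + G a \<bullet> (b - a) + (L - \<rho>) / 2 * (norm (b - a))\<^sup>2" for a b
    using L_smooth_upper_bound[OF smooth, of b a] expand[where a = a and b = b]
    unfolding h_def G diff_divide_distrib left_diff_distrib by linarith
  have w: "w x y - \<rho> *\<^sub>R (x - y) = G x - G y"
    "L *\<^sub>R (x - y) - w x y = (L - \<rho>) *\<^sub>R (x - y) - (G x - G y)"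
    by (simp_all add: w_def G_def algebra_simps)
  show "0 \<le> (w x y - \<rho> *\<^sub>R (x - y)) \<bullet> (L *\<^sub>R (x - y) - w x y)"
    using cocoercive_if_quadratic_bounds[OF lower upper, of x y]
    unfolding w by (simp add: inner_diff_right power2_norm_eq_inner)
  have "0 \<le> (w x y - \<rho> *\<^sub>R (x - y)) \<bullet> (x - y)"
    using lower[of x y] lower[of y x] unfolding w by (simp add: algebra_simps)
  then show "\<rho> * (norm (x - y))\<^sup>2 \<le> w x y \<bullet> (x - y)"
    by (simp add: inner_diff_left power2_norm_eq_inner)
  show "\<rho> \<le> L" if "x \<noteq> y"
  proof -
    have "0 \<le> (L - \<rho>) / 2 * (norm (y - x))\<^sup>2"
      using lower[of x y] upper[of y x] by simp
    then show ?thesis using that by (simp add: zero_le_mult_iff)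
  qed
qed

section \<open>Logarithmic norms and monotone vector fields\<close>

lemma is_norm_linear_inj:
  fixes T :: "'a::real_vector \<Rightarrow> 'b::real_normed_vector"
  assumes "linear T" "inj T"
  shows "is_norm (\<lambda>x. norm (T x))"
  unfolding is_norm_def
  by (simp add: linear_add[OF assms(1)] linear_cmul[OF assms(1)] norm_triangle_ineq
      linear_injective_0[OF assms(1)] linear_inj_iff_eq_0[OF assms(1)])
    (use assms linear_inj_iff_eq_0 linear_0 in blast)

context
  fixes T :: "real^'k \<Rightarrow> 'b::euclidean_space" and N :: "real^'k \<Rightarrow> real"
  assumes linear_T: "linear T" and inj_T: "inj T" and N: "N = (\<lambda>x. norm (T x))"
begin

lemma bounded_image_on_sphere: "\<exists>C\<ge>0. \<forall>x. N x = 1 \<longrightarrow> N (M *v x) \<le> C"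
proof -
  obtain B where B: "0 < B" "\<And>x. B * norm x \<le> norm (T x)"
    using linear_inj_bounded_below_pos[OF linear_T inj_T] by metis
  have "linear (\<lambda>x. T (M *v x))"
    using linear_compose[OF matrix_vector_mul_linear linear_T] by (simp add: o_def)
  then obtain K where K: "0 < K" "\<And>x. norm (T (M *v x)) \<le> K * norm x"
    using linear_bounded_pos by blast
  have "norm (T (M *v x)) \<le> K / B" if "norm (T x) = 1" for x
  proof -
    have "norm x \<le> 1 / B" using B(2)[of x] that B(1) by (simp add: field_simps)
    then have "K * norm x \<le> K * (1 / B)" using K(1) by (intro mult_left_mono) auto
    then show ?thesis using K(2)[of x] by simp
  qed
  then show ?thesis unfolding N using B(1) K(1) by (intro exI[of _ "K / B"]) auto
qed

lemma sphere_nonempty: "{x. N x = 1} \<noteq> {}"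
proof -
  define e :: "real^'k" where "e = axis undefined 1"
  have "T e \<noteq> 0"
    using linear_injective_0[OF linear_T] inj_T by (auto simp: e_def axis_eq_0_iff)
  then have "N (inverse (norm (T e)) *\<^sub>R e) = 1" by (simp add: N linear_cmul[OF linear_T])
  then show ?thesis by blast
qed

lemma le_induced_norm:
  assumes "N x = 1"
  shows "N (M *v x) \<le> induced_norm N M"
proof -
  obtain C where "\<And>x. N x = 1 \<Longrightarrow> N (M *v x) \<le> C" using bounded_image_on_sphere[of M] by blast
  then show ?thesis
    unfolding induced_norm_def using assms by (intro cSUP_upper bdd_aboveI2[where M = C]) auto
qed

lemma induced_norm_le: "(\<And>x. N x = 1 \<Longrightarrow> N (M *v x) \<le> c) \<Longrightarrow> induced_norm N M \<le> c"
  unfolding induced_norm_def using sphere_nonempty by (intro cSUP_least) auto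

text \<open>
  Expanding the square, \<open>N ((I + h M) x)\<^sup>2 \<le> 1 + h\<^sup>2 C\<^sup>2\<close> on the unit sphere, so the quotient in the
  definition is at most \<open>h C\<^sup>2 / 2\<close>.  That the limit exists at all follows from convexity of the
  norm: the quotient is nondecreasing in \<open>h\<close> and bounded below by \<open>- C\<close>, so it converges to its
  infimum.
\<close>

lemma log_norm_nonpos:
  assumes dissipative: "\<And>v. T v \<bullet> T (M *v v) \<le> 0"
  shows "log_norm N M \<le> 0"
proof -
  define q where "q h = (induced_norm N (mat 1 + h *\<^sub>R M) - 1) / h" for h
  have step: "(mat 1 + h *\<^sub>R M) *v x = x + h *\<^sub>R (M *v x)" for h x
    by (simp add: matrix_vector_mult_add_rdistrib scaleR_matrix_vector_assoc)
  obtain C where C: "0 \<le> C" "\<And>x. N x = 1 \<Longrightarrow> N (M *v x) \<le> C"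
    using bounded_image_on_sphere[of M] by blast
  have mono: "q h \<le> q h'" if "0 < h" "h \<le> h'" for h h'
  proof -
    have "induced_norm N (mat 1 + h *\<^sub>R M) \<le> (1 - h / h') + h / h' * induced_norm N (mat 1 + h' *\<^sub>R M)"
    proof (rule induced_norm_le)
      fix x assume x: "N x = 1"
      have "x + h *\<^sub>R (M *v x) = (1 - h / h') *\<^sub>R x + (h / h') *\<^sub>R (x + h' *\<^sub>R (M *v x))"
        using that by (simp add: algebra_simps)
      then have "N (x + h *\<^sub>R (M *v x)) \<le> (1 - h / h') * N x + h / h' * N (x + h' *\<^sub>R (M *v x))"
        using norm_triangle_ineq[of "T ((1 - h / h') *\<^sub>R x)" "T ((h / h') *\<^sub>R (x + h' *\<^sub>R (M *v x)))"] that
        by (simp add: N linear_add[OF linear_T, symmetric])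
          (simp add: linear_cmul[OF linear_T])
      also have "\<dots> \<le> (1 - h / h') + h / h' * induced_norm N (mat 1 + h' *\<^sub>R M)"
        using le_induced_norm[OF x, of "mat 1 + h' *\<^sub>R M"] that unfolding step x
        by (intro add_mono mult_left_mono) auto
      finally show "N ((mat 1 + h *\<^sub>R M) *v x) \<le> (1 - h / h') + h / h' * induced_norm N (mat 1 + h' *\<^sub>R M)"
        unfolding step .
    qed
    then have "induced_norm N (mat 1 + h *\<^sub>R M) - 1 \<le> h / h' * (induced_norm N (mat 1 + h' *\<^sub>R M) - 1)"
      unfolding right_diff_distrib by simp
    then have "q h \<le> h / h' * (induced_norm N (mat 1 + h' *\<^sub>R M) - 1) / h"
      unfolding q_def using that by (intro divide_right_mono) auto
    then show ?thesis using that by (simp add: q_def)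
  qed
  have lower: "- C \<le> q h" if "0 < h" for h
  proof -
    obtain x where x: "N x = 1" using sphere_nonempty by blast
    have "N x - h * N (M *v x) \<le> N (x + h *\<^sub>R (M *v x))"
      using norm_diff_ineq[of "T x" "T (h *\<^sub>R (M *v x))"] that
      by (simp add: N linear_add[OF linear_T] linear_cmul[OF linear_T])
    also have "\<dots> \<le> induced_norm N (mat 1 + h *\<^sub>R M)"
      using le_induced_norm[OF x, of "mat 1 + h *\<^sub>R M"] by (simp add: step)
    finally have "1 - h * N (M *v x) \<le> induced_norm N (mat 1 + h *\<^sub>R M)" by (simp only: x)
    moreover have "h * N (M *v x) \<le> h * C" using C(2)[OF x] that by (intro mult_left_mono) auto
    ultimately have "1 - h * C \<le> induced_norm N (mat 1 + h *\<^sub>R M)" by linarith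
    then show ?thesis using that by (simp add: q_def field_simps)
  qed
  have upper: "q h \<le> h * (C\<^sup>2 / 2)" if "0 < h" for h
  proof -
    have "induced_norm N (mat 1 + h *\<^sub>R M) \<le> 1 + h\<^sup>2 * C\<^sup>2 / 2"
    proof (rule induced_norm_le)
      fix x assume x: "N x = 1"
      have "(N (x + h *\<^sub>R (M *v x)))\<^sup>2 = (N x)\<^sup>2 + 2 * h * (T x \<bullet> T (M *v x)) + h\<^sup>2 * (N (M *v x))\<^sup>2"
        unfolding N power2_norm_eq_inner linear_add[OF linear_T] linear_cmul[OF linear_T]
        by (simp add: inner_add_left inner_add_right inner_commute power2_eq_square algebra_simps)
      also have "\<dots> \<le> 1 + 0 + h\<^sup>2 * C\<^sup>2"
        using dissipative[of x] C(2)[OF x] x that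
        by (intro add_mono mult_left_mono power_mono) (auto simp: mult_nonneg_nonpos N)
      also have "\<dots> \<le> (1 + h\<^sup>2 * C\<^sup>2 / 2)\<^sup>2"
        using zero_le_power2[of "h\<^sup>2 * C\<^sup>2 / 2"] unfolding power2_sum one_power2 by linarith
      finally have "N (x + h *\<^sub>R (M *v x)) \<le> 1 + h\<^sup>2 * C\<^sup>2 / 2"
        by (rule power2_le_imp_le) simp
      then show "N ((mat 1 + h *\<^sub>R M) *v x) \<le> 1 + h\<^sup>2 * C\<^sup>2 / 2" by (simp add: step)
    qed
    then show ?thesis using that by (simp add: q_def field_simps power2_eq_square)
  qed
  define l where "l = (INF h\<in>{0<..}. q h)"
  have bdd: "bdd_below (q ` {0<..})" using lower by (intro bdd_belowI2) auto
  have l_le: "l \<le> q h" if "0 < h" for h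
    unfolding l_def using bdd that by (intro cINF_lower) auto
  have "(q \<longlongrightarrow> l) (at_right 0)"
  proof (rule decreasing_tendsto)
    show "\<forall>\<^sub>F h in at_right 0. l \<le> q h"
      using l_le by (auto simp: eventually_at_right_field intro!: exI[of _ 1])
    fix c assume "l < c"
    then obtain h where h: "0 < h" "q h < c"
      unfolding l_def using bdd by (subst (asm) cINF_less_iff) auto
    then show "\<forall>\<^sub>F h in at_right 0. q h < c"
      unfolding eventually_at_right_field
      using mono[of _ h] by (meson less_imp_le order_le_less_trans)
  qed
  then have "log_norm N M = l"
    unfolding log_norm_def q_def by (intro tendsto_Lim) auto
  moreover have "l \<le> 0"
    using l_le upper by (intro nonpos_if_le_multiple[of l "C\<^sup>2 / 2"]) (meson order_trans)
  ultimately show ?thesis by simp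
qed

end

text \<open>
  If the inner product were positive, \<open>T v \<bullet> T (F (z + t v))\<close> would exceed its value at \<open>t = 0\<close> for
  small \<open>t > 0\<close>, against monotonicity for the pair \<open>z + t v\<close>, \<open>z\<close>.
\<close>

lemma derivative_dissipative_if_monotone:
  fixes F :: "'a::real_normed_vector \<Rightarrow> 'a" and T :: "'a \<Rightarrow> 'b::real_inner"
  assumes T: "bounded_linear T"
    and mono: "\<And>x y. T (F x - F y) \<bullet> T (x - y) \<le> 0"
    and F': "(F has_derivative F') (at z)"
  shows "T v \<bullet> T (F' v) \<le> 0"
proof (rule ccontr)
  assume pos: "\<not> ?thesis"
  define \<psi> where "\<psi> t = T v \<bullet> T (F (z + t *\<^sub>R v))" for t :: real
  have lin: "linear T" using T by (rule bounded_linear.linear)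
  have "((\<lambda>t. z + t *\<^sub>R v) has_derivative (\<lambda>s. s *\<^sub>R v)) (at 0)"
    by (auto intro!: derivative_eq_intros)
  moreover have "(F has_derivative F') (at (z + 0 *\<^sub>R v))" using F' by simp
  ultimately have "((\<lambda>t. F (z + t *\<^sub>R v)) has_derivative (\<lambda>s. F' (s *\<^sub>R v))) (at 0)"
    by (rule has_derivative_compose)
  from bounded_linear.has_derivative[OF bounded_linear_compose[OF bounded_linear_inner_right T] this]
  have "(\<psi> has_derivative (\<lambda>s. T v \<bullet> T (F' (s *\<^sub>R v)))) (at 0)"
    by (simp add: \<psi>_def[abs_def])
  moreover have "T v \<bullet> T (F' (s *\<^sub>R v)) = T v \<bullet> T (F' v) * s" for s
    by (simp add: linear_cmul[OF has_derivative_linear[OF F']] linear_cmul[OF lin])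
  ultimately have "(\<psi> has_real_derivative T v \<bullet> T (F' v)) (at 0)"
    by (simp add: has_field_derivative_def)
  then obtain d where "0 < d" "\<And>h. 0 < h \<Longrightarrow> h < d \<Longrightarrow> \<psi> 0 < \<psi> (0 + h)"
    using DERIV_pos_inc_right[of \<psi> "T v \<bullet> T (F' v)" 0] pos by auto
  then have "\<psi> 0 < \<psi> (d / 2)" by simp
  moreover have "(d / 2) * (\<psi> (d / 2) - \<psi> 0) \<le> 0"
    using mono[of "z + (d / 2) *\<^sub>R v" z]
    by (simp add: \<psi>_def linear_diff[OF lin] linear_cmul[OF lin] inner_diff_right inner_commute right_diff_distrib)
  ultimately show False using \<open>0 < d\<close> by (simp add: mult_le_0_iff)
qed

theorem weakly_inf_contracting_if_monotone:
  fixes T :: "real^'k \<Rightarrow> 'b::euclidean_space"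
  assumes T: "linear T" "inj T" and N: "N = (\<lambda>x. norm (T x))"
    and lip: "L-lipschitz_on UNIV F"
    and mono: "\<And>x y. T (F x - F y) \<bullet> T (x - y) \<le> 0"
  shows "weakly_inf_contracting N F"
  unfolding weakly_inf_contracting_def
proof (intro conjI)
  show "is_norm N" unfolding N by (rule is_norm_linear_inj[OF T])
  show "locally_lipschitz F"
    unfolding locally_lipschitz_def
    using lipschitz_on_subset[OF lip] by (metis subset_UNIV zero_less_one)
  show "AE z in lebesgue. F differentiable (at z) \<and> log_norm N (jacobian F (at z)) \<le> 0"
    using Rademacher[OF lip]
  proof eventually_elim
    case (elim z)
    have bl: "bounded_linear T" using T(1) by (simp add: linear_conv_bounded_linear)
    have "(F has_derivative (\<lambda>h. jacobian F (at z) *v h)) (at z)"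
      using elim jacobian_works by blast
    from derivative_dissipative_if_monotone[OF bl mono this]
    show ?case using elim by (intro conjI log_norm_nonpos[OF T N]) auto
  qed
qed

section \<open>The proximal dynamics\<close>

lemma upper_lower_simps [simp]:
  "upper (stack x y) = x" "lower (stack x y) = y"
  "upper (z + w) = upper z + upper w" "lower (z + w) = lower z + lower w"
  "upper (z - w) = upper z - upper w" "lower (z - w) = lower z - lower w"
  "upper (c *\<^sub>R z) = c *\<^sub>R upper z" "lower (c *\<^sub>R z) = c *\<^sub>R lower z"
  by (simp_all add: upper_def lower_def stack_def vec_eq_iff)

lemma stack_upper_lower: "stack (upper z) (lower z) = z"
  by (simp add: upper_def lower_def stack_def vec_eq_iff split: sum.split)

lemma sum_over_sum_type:
  fixes h :: "'a::finite + 'b::finite \<Rightarrow> 'c::comm_monoid_add"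
  shows "(\<Sum>k\<in>UNIV. h k) = (\<Sum>i\<in>UNIV. h (Inl i)) + (\<Sum>j\<in>UNIV. h (Inr j))"
  unfolding UNIV_Plus_UNIV[symmetric] by (subst sum.Plus) auto

lemma inner_upper_lower: "z \<bullet> w = upper z \<bullet> upper w + lower z \<bullet> lower w"
  by (simp add: inner_vec_def upper_def lower_def sum_over_sum_type)

lemma upper_lower_block_matrix_mult:
  "upper (block_matrix A B C D *v z) = A *v upper z + B *v lower z"
  "lower (block_matrix A B C D *v z) = C *v upper z + D *v lower z"
  by (simp_all add: vec_eq_iff upper_def lower_def block_matrix_def matrix_vector_mult_def
      sum_over_sum_type)

lemma lipschitz_on_upper_lower: "1-lipschitz_on U upper" "1-lipschitz_on U lower"
proof -
  have "norm (upper z) \<le> norm z" "norm (lower z) \<le> norm z" for z :: "real^('n::finite + 'm::finite)"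
    unfolding norm_eq_sqrt_inner inner_upper_lower[of z z] by simp_all
  from this[of "_ - _"] show "1-lipschitz_on U upper" "1-lipschitz_on U lower"
    by (auto intro!: lipschitz_onI simp: dist_norm)
qed

lemma lipschitz_on_stack:
  assumes a: "C-lipschitz_on U a" and b: "D-lipschitz_on U b"
  shows "(C + D)-lipschitz_on U (\<lambda>z. stack (a z) (b z))"
proof (rule lipschitz_onI)
  fix x y assume "x \<in> U" "y \<in> U"
  have norm_le: "norm z \<le> norm (upper z) + norm (lower z)" for z :: "real^('k::finite + 'l::finite)"
    unfolding norm_eq_sqrt_inner[of z] inner_upper_lower[of z z]
    by (metis norm_ge_zero power2_norm_eq_inner sqrt_sum_squares_le_sum)
  have "dist (stack (a x) (b x)) (stack (a y) (b y)) \<le> dist (a x) (a y) + dist (b x) (b y)"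
    using norm_le[of "stack (a x) (b x) - stack (a y) (b y)"] by (simp add: dist_norm)
  also have "\<dots> \<le> (C + D) * dist x y"
    using lipschitz_onD[OF a \<open>x \<in> U\<close> \<open>y \<in> U\<close>] lipschitz_onD[OF b \<open>x \<in> U\<close> \<open>y \<in> U\<close>]
    by (simp add: distrib_right)
  finally show "dist (stack (a x) (b x)) (stack (a y) (b y)) \<le> (C + D) * dist x y" .
qed (simp add: lipschitz_on_nonneg[OF a] lipschitz_on_nonneg[OF b])

lemma lipschitz_prox_PI_field:
  fixes f :: "real^'n \<Rightarrow> real" and A :: "real^'n^'m"
  assumes f: "L_smooth L f" and g: "ccp g" and "0 < \<gamma>"
  shows "\<exists>C. C-lipschitz_on UNIV (prox_PI_field \<gamma> k\<^sub>p k\<^sub>i f g A b)"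
proof -
  let ?U = "UNIV :: (real^('n + 'm)) set"
  obtain a where a: "\<And>S. a-lipschitz_on S ((*v) A)"
    by (metis bounded_linear.lipschitz_boundE lipschitz_on_subset matrix_vector_mul_bounded_linear subset_UNIV)
  obtain a' where a': "\<And>S. a'-lipschitz_on S ((*v) (transpose A))"
    by (metis bounded_linear.lipschitz_boundE lipschitz_on_subset matrix_vector_mul_bounded_linear subset_UNIV)
  have grad: "L-lipschitz_on S (gradient f)" for S
    using f lipschitz_on_subset[OF _ subset_UNIV] by (auto simp: L_smooth_def)
  have prox: "1-lipschitz_on S (prox \<gamma> g)" for S
    by (rule lipschitz_on_subset[OF prox_nonexpansive[OF g \<open>0 < \<gamma>\<close>] subset_UNIV])
  obtain c where "c-lipschitz_on ?U
      (\<lambda>z. upper z - \<gamma> *\<^sub>R (gradient f (upper z) + transpose A *v lower z))"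
    using lipschitz_on_diff[OF lipschitz_on_upper_lower(1) lipschitz_on_cmult[OF
        lipschitz_on_add[OF lipschitz_on_compose2[OF lipschitz_on_upper_lower(1) grad]
          lipschitz_on_compose2[OF lipschitz_on_upper_lower(2) a']]]] by blast
  note y = lipschitz_on_compose2[OF this prox]
  note top = lipschitz_on_add[OF lipschitz_on_minus[OF lipschitz_on_upper_lower(1)] y]
  note bottom = lipschitz_on_diff[OF lipschitz_on_add[OF
      lipschitz_on_cmult[OF lipschitz_on_compose2[OF lipschitz_on_upper_lower(1) a]]
      lipschitz_on_cmult[OF lipschitz_on_compose2[OF y a]]] lipschitz_on_constant]
  show ?thesis
    unfolding prox_PI_field_def Let_def by (rule exI) (rule lipschitz_on_stack[OF top bottom])
qed

text \<open>
  By the Cauchy-Schwarz and the arithmetic-geometric mean inequality it suffices that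
  \<open>\<parallel>(p + q) x - k w\<parallel>\<^sup>2 \<le> 4 p q \<parallel>x\<parallel>\<^sup>2\<close>.  The first hypothesis on \<open>w\<close> makes the left side at most an affine
  function of \<open>w \<bullet> x\<close>, decreasing because \<open>k (\<rho> + L) \<le> 2 (p + q)\<close>; at the least value
  \<open>w \<bullet> x = \<rho> \<parallel>x\<parallel>\<^sup>2\<close> it equals \<open>(p + q - k \<rho>)\<^sup>2 \<parallel>x\<parallel>\<^sup>2\<close>.
\<close>

lemma cross_term_bound:
  fixes x y w :: "'a::real_inner" and p q k \<rho> L :: real
  assumes w: "0 \<le> (w - \<rho> *\<^sub>R x) \<bullet> (L *\<^sub>R x - w)" "\<rho> * (norm x)\<^sup>2 \<le> w \<bullet> x"
    and "0 < k" "0 < \<rho>" "\<rho> \<le> L"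
    and p: "k * L \<le> 3 * p" "q - 2 * k * \<rho> \<le> p" "p \<le> q" "k * L \<le> q"
  shows "((p + q) *\<^sub>R x - k *\<^sub>R w) \<bullet> y \<le> p * (norm x)\<^sup>2 + q * (norm y)\<^sup>2"
proof -
  define v where "v = (p + q) *\<^sub>R x - k *\<^sub>R w"
  have "0 < k * L" using assms by simp
  then have "0 < p" "0 < q" using p by linarith+
  have "k * \<rho> \<le> k * L" using assms by simp
  have "(p + q - k * \<rho>)\<^sup>2 \<le> 4 * p * q"
  proof -
    \<comment> \<open>Both correction terms are nonpositive: \<open>0 \<le> q - p \<le> 2 k \<rho>\<close> and \<open>k \<rho> \<le> k L \<le> 3 p\<close>.\<close>
    have "(p + q - k * \<rho>)\<^sup>2 = 4 * p * q + (q - p) * (q - p - 2 * (k * \<rho>)) + k * \<rho> * (k * \<rho> - 4 * p)"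
      by (simp add: power2_eq_square algebra_simps)
    moreover have "(q - p) * (q - p - 2 * (k * \<rho>)) \<le> 0"
      using p by (intro mult_nonneg_nonpos) auto
    moreover have "k * \<rho> * (k * \<rho> - 4 * p) \<le> 0"
    proof (rule mult_nonneg_nonpos)
      show "k * \<rho> - 4 * p \<le> 0"
        using \<open>k * \<rho> \<le> k * L\<close> p(1) \<open>0 < p\<close> by linarith
    qed (use assms in simp)
    ultimately show ?thesis by linarith
  qed
  have "(norm w)\<^sup>2 \<le> (\<rho> + L) * (w \<bullet> x) - \<rho> * L * (norm x)\<^sup>2"
    using w(1) unfolding power2_norm_eq_inner
    by (simp add: inner_diff_left inner_diff_right inner_commute algebra_simps)
  then have "k\<^sup>2 * (norm w)\<^sup>2 \<le> k\<^sup>2 * ((\<rho> + L) * (w \<bullet> x) - \<rho> * L * (norm x)\<^sup>2)"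
    by (rule mult_left_mono) simp
  moreover have "(norm v)\<^sup>2 = (p + q)\<^sup>2 * (norm x)\<^sup>2 - 2 * (p + q) * k * (w \<bullet> x) + k\<^sup>2 * (norm w)\<^sup>2"
    unfolding v_def power2_norm_eq_inner
    by (simp add: inner_diff_left inner_diff_right inner_commute power2_eq_square algebra_simps)
  moreover have "k * (2 * (p + q) - k * (\<rho> + L)) * (\<rho> * (norm x)\<^sup>2) \<le>
      k * (2 * (p + q) - k * (\<rho> + L)) * (w \<bullet> x)"
    using w(2)
  proof (rule mult_left_mono)
    have "k * (\<rho> + L) \<le> 2 * (p + q)"
      using p \<open>k * \<rho> \<le> k * L\<close> by (simp add: algebra_simps)
    then show "0 \<le> k * (2 * (p + q) - k * (\<rho> + L))" using \<open>0 < k\<close> by simp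
  qed
  ultimately have "(norm v)\<^sup>2 \<le> (p + q - k * \<rho>)\<^sup>2 * (norm x)\<^sup>2"
    by (simp add: power2_eq_square algebra_simps)
  also have "\<dots> \<le> 4 * p * q * (norm x)\<^sup>2"
    using \<open>(p + q - k * \<rho>)\<^sup>2 \<le> 4 * p * q\<close> by (rule mult_right_mono) simp
  finally have v: "(norm v)\<^sup>2 \<le> 4 * p * q * (norm x)\<^sup>2" .
  have "(norm v * norm y)\<^sup>2 \<le> 4 * p * q * (norm x)\<^sup>2 * (norm y)\<^sup>2"
    using mult_right_mono[OF v, of "(norm y)\<^sup>2"] by (simp add: power_mult_distrib)
  also have "\<dots> \<le> (p * (norm x)\<^sup>2 + q * (norm y)\<^sup>2)\<^sup>2"
    using zero_le_power2[of "p * (norm x)\<^sup>2 - q * (norm y)\<^sup>2"]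
    by (simp add: power2_eq_square algebra_simps)
  finally have "norm v * norm y \<le> p * (norm x)\<^sup>2 + q * (norm y)\<^sup>2"
    by (rule power2_le_imp_le) (use \<open>0 < p\<close> \<open>0 < q\<close> in simp)
  then show ?thesis
    using norm_cauchy_schwarz[of v y] by (simp add: v_def)
qed

text \<open>
  The incremental inequality in the inner product of \<open>P\<close>.  The transpose in the proximal argument
  matches the matrix in the dual equation, so firm nonexpansiveness of the proximal operator,
  multiplied by \<open>q = k / \<gamma>\<close>, is precisely a bound on the dual contribution \<open>k (l \<bullet> A y)\<close>.
\<close>

lemma prox_PI_field_monotone:
  fixes f :: "real^'n \<Rightarrow> real" and A :: "real^'n^'m" and b :: "real^'m"
  assumes f: "strongly_convex \<rho> f" "L_smooth L f" and g: "ccp g"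
    and pos: "0 < \<rho>" "0 < \<gamma>" "0 < k"
    and p: "k * L \<le> 3 * p" "k / \<gamma> - 2 * k * \<rho> \<le> p" "p \<le> k / \<gamma>" "k * L \<le> k / \<gamma>"
  defines "F \<equiv> prox_PI_field \<gamma> k k f g A b"
  shows "p * (upper (F z - F z') \<bullet> upper (z - z')) + lower (F z - F z') \<bullet> lower (z - z') \<le> 0"
proof -
  define U where "U z = upper z - \<gamma> *\<^sub>R (gradient f (upper z) + transpose A *v lower z)"
    for z :: "real^('n + 'm)"
  define Y where "Y z = prox \<gamma> g (U z)" for z
  define x l y w where "x = upper (z - z')" and "l = lower (z - z')" and "y = Y z - Y z'"
    and "w = gradient f (upper z) - gradient f (upper z')"
  define q where "q = k / \<gamma>"
  have "0 < q" "q * \<gamma> = k" using pos by (simp_all add: q_def)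
  have F: "F z = stack (- upper z + Y z) (k *\<^sub>R (A *v Y z) - k *\<^sub>R b)" for z
    by (simp add: F_def prox_PI_field_def Y_def U_def Let_def)
  have field: "upper (F z - F z') = y - x" "lower (F z - F z') = k *\<^sub>R (A *v y)"
    by (simp_all add: F x_def y_def matrix_vector_mult_diff_distrib scaleR_diff_right)
  have adj: "y \<bullet> (transpose A *v l) = l \<bullet> (A *v y)"
    by (simp add: transpose_matrix_vector dot_lmul_matrix inner_commute[of y])
  have U: "U z - U z' = x - \<gamma> *\<^sub>R (w + transpose A *v l)"
    by (simp add: U_def x_def w_def l_def matrix_vector_mult_diff_distrib algebra_simps
        del: transpose_matrix_vector)
  have "(norm y)\<^sup>2 \<le> y \<bullet> (x - \<gamma> *\<^sub>R (w + transpose A *v l))"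
    unfolding y_def Y_def U[symmetric] by (rule prox_firmly_nonexpansive[OF g pos(2)])
  then have "(norm y)\<^sup>2 \<le> y \<bullet> x - \<gamma> * (y \<bullet> w) - \<gamma> * (l \<bullet> (A *v y))"
    by (simp add: inner_diff_right inner_add_right adj algebra_simps del: transpose_matrix_vector)
  then have "q * (norm y)\<^sup>2 \<le> q * (y \<bullet> x - \<gamma> * (y \<bullet> w) - \<gamma> * (l \<bullet> (A *v y)))"
    using \<open>0 < q\<close> by (intro mult_left_mono) auto
  also have "\<dots> = q * (y \<bullet> x) - q * \<gamma> * (y \<bullet> w) - q * \<gamma> * (l \<bullet> (A *v y))"
    by (simp add: algebra_simps)
  finally have dual: "k * (l \<bullet> (A *v y)) \<le> q * (x \<bullet> y) - k * (w \<bullet> y) - q * (norm y)\<^sup>2"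
    unfolding \<open>q * \<gamma> = k\<close> by (simp add: inner_commute)
  have cross: "((p + q) *\<^sub>R x - k *\<^sub>R w) \<bullet> y \<le> p * (norm x)\<^sup>2 + q * (norm y)\<^sup>2"
  proof (cases "upper z = upper z'")
    case True
    then show ?thesis using \<open>0 < q\<close> by (simp add: x_def w_def)
  next
    case False
    from gradient_difference_bounds[OF f, of "upper z" "upper z'"] False
    show ?thesis
      using pos p by (intro cross_term_bound[where \<rho> = \<rho> and L = L]) (auto simp: x_def w_def q_def)
  qed
  have "p * ((y - x) \<bullet> x) + (k *\<^sub>R (A *v y)) \<bullet> l =
      k * (l \<bullet> (A *v y)) + p * (x \<bullet> y) - p * (norm x)\<^sup>2"
    by (simp add: inner_diff_left power2_norm_eq_inner inner_commute algebra_simps)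
  also have "\<dots> \<le> ((p + q) *\<^sub>R x - k *\<^sub>R w) \<bullet> y - p * (norm x)\<^sup>2 - q * (norm y)\<^sup>2"
    using dual by (simp add: inner_diff_left algebra_simps)
  also have "\<dots> \<le> 0" using cross by simp
  finally show ?thesis unfolding field x_def[symmetric] l_def[symmetric] .
qed

theorem lemma2:
  fixes f :: "real^'n \<Rightarrow> real" and g :: "real^'n \<Rightarrow> ereal"
    and A :: "real^'n^'m" and b :: "real^'m"
    and \<rho> L k\<^sub>p k\<^sub>i \<gamma> p :: real
  assumes feasible: "\<exists>xbar. A *v xbar = b"
    and "\<rho> > 0" and "strongly_convex \<rho> f"
    and "L > 0" and "L_smooth L f"
    and "ccp g"
    and "k\<^sub>p = k\<^sub>i" and "k\<^sub>i > 0"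
    and "\<gamma> \<in> {0<..1 / L}"
    and "p \<in> {max (k\<^sub>p * L / 3) (k\<^sub>p * (1 - 2 * \<gamma> * \<rho>) / \<gamma>) .. k\<^sub>p / \<gamma>}"
  shows "weakly_inf_contracting
           (weighted_norm (block_matrix (p *\<^sub>R mat 1) 0 0 (mat 1)))
           (prox_PI_field \<gamma> k\<^sub>p k\<^sub>i f g A b)"
proof -
  define k where "k = k\<^sub>i"
  have k: "k\<^sub>p = k" "k\<^sub>i = k" "0 < k" using assms by (simp_all add: k_def)
  have \<gamma>: "0 < \<gamma>" "L * \<gamma> \<le> 1" using assms by (auto simp: field_simps)
  have p: "k * L \<le> 3 * p" "k / \<gamma> - 2 * k * \<rho> \<le> p" "p \<le> k / \<gamma>"
    using assms \<gamma> unfolding k by (auto simp: field_simps)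
  have "k * (L * \<gamma>) \<le> k * 1" using k(3) \<gamma>(2) by (intro mult_left_mono) auto
  then have kL: "k * L \<le> k / \<gamma>" using \<gamma>(1) by (simp add: field_simps)
  have "0 < k * L" using k(3) \<open>0 < L\<close> by simp
  then have "0 < p" using p(1) by linarith
  define T :: "real^('n + 'm) \<Rightarrow> (real^'n) \<times> (real^'m)" where "T z = (sqrt p *\<^sub>R upper z, lower z)" for z
  have inner_T: "T z \<bullet> T w = p * (upper z \<bullet> upper w) + lower z \<bullet> lower w" for z w
    using \<open>0 < p\<close> by (simp add: T_def inner_prod_def flip: mult.assoc)
  have "linear T"
    by (rule linearI) (simp_all add: T_def scaleR_add_right scaleR_left_commute)
  have "inj T"
  proof (rule inj_on_inverseI)
    show "(\<lambda>(u, l). stack ((1 / sqrt p) *\<^sub>R u) l) (T z) = z" for z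
      using \<open>0 < p\<close> by (simp add: T_def stack_upper_lower)
  qed
  have N: "weighted_norm (block_matrix (p *\<^sub>R mat 1) 0 0 (mat 1)) = (\<lambda>z. norm (T z))"
    unfolding weighted_norm_def norm_eq_sqrt_inner inner_T inner_upper_lower[of _ "_ *v _"]
      upper_lower_block_matrix_mult
    by (simp flip: scaleR_matrix_vector_assoc)
  obtain C where C: "C-lipschitz_on UNIV (prox_PI_field \<gamma> k k f g A b)"
    using lipschitz_prox_PI_field[OF \<open>L_smooth L f\<close> \<open>ccp g\<close> \<gamma>(1)] by blast
  show ?thesis
    unfolding k(1,2)
  proof (rule weakly_inf_contracting_if_monotone[OF \<open>linear T\<close> \<open>inj T\<close> N C])
    show "T (prox_PI_field \<gamma> k k f g A b z - prox_PI_field \<gamma> k k f g A b z') \<bullet> T (z - z') \<le> 0" for z z'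
      unfolding inner_T
      by (rule prox_PI_field_monotone[OF \<open>strongly_convex \<rho> f\<close> \<open>L_smooth L f\<close> \<open>ccp g\<close> \<open>\<rho> > 0\<close> \<gamma>(1) k(3) p kL])
  qed
qed

end
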